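(* Let $\mathcal C\subset\mathbb{R}^{nd}\times\mathbb{R}^n_{\ge0}$ be a closed, convex set with nonempty interior such that (i) the saddle points of $L_{\mathrm{aug}}$ over $(\mathbb{R}^{nd}\times\mathbb{R}^n_{\ge0})\times(\mathbb{R}^n\times\mathbb{R}^{nd})$ are contained in $\mathcal C\times(\mathbb{R}^n\times\mathbb{R}^{nd})$; (ii) $\tilde L_{\mathrm{aug}}$ is convex-concave on $\mathcal C\times(\mathbb{R}^n\times\mathbb{R}^{nd}\times\mathbb{R}^{mN})$, i.e. convex in $(x_{\mathrm v},\lambda_{\mathrm v})\in\mathcal C$ and concave in $(\nu,\eta,\{\xi^k\})$; (iii) for any $(\nu,\eta)\in\mathbb{R}^n\times\mathbb{R}^{nd}$, $$\min_{(x_{\mathrm v},\lambda_{\mathrm v})\in\mathcal C}\;\max_{\{\xi^k\}}\tilde L_{\mathrm{aug}}(x_{\mathrm v},\lambda_{\mathrm v},\nu,\eta,\{\xi^k\})=\max_{\{\xi^k\}}\;\min_{(x_{\mathrm v},\lambda_{\mathrm v})\in\mathcal C}\tilde L_{\mathrm{aug}}(x_{\mathrm v},\lambda_{\mathrm v},\nu,\eta,\{\xi^k\}).$$ Assume further that there exists a saddle point $(x_{\mathrm v}^*,\lambda_{\mathrm v}^*,\nu^*,\eta^*,\{(\xi^k)^*\})$ of $\tilde L_{\mathrm{aug}}$ over $\mathcal C\times(\mathbb{R}^n\times\mathbb{R}^{nd}\times\mathbb{R}^{mN})$ with $(x_{\mathrm v}^*,\lambda_{\mathrm v}^* )\in\mathrm{int}(\mathcal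 C)$ such that the map $\xi\mapsto g_k((x_{\mathrm v}^* )^{v_k},(\lambda_{\mathrm v}^* )^{v_k},\xi)$ is strongly concave for all $k\in\{1,\dots,N\}$. Then the trajectories of the saddle-point dynamics (SP) stated in the context starting in $\mathcal C\times\mathbb{R}^n\times\mathbb{R}^{nd}\times\mathbb{R}^{mN}$ remain in this set and converge asymptotically (as $t\to\infty$) to a saddle point of $\tilde L_{\mathrm{aug}}$ over $\mathcal C\times(\mathbb{R}^n\times\mathbb{R}^{nd}\times\mathbb{R}^{mN})$. As a consequence, the $(x_{\mathrm v},\lambda_{\mathrm v})$ component of the trajectory converges to an optimizer of problem (D) stated in the context.
   Context: $n,N,d,m$ are positive integers and $\epsilon\ge 0$. $\mathcal G$ is a connected undirected weighted graph on the vertex set $\{1,\dots,n\}$ (the agents) with symmetric adjacency matrix $\mathsf A=(a_{ij})$, $a_{ij}>0$ if $(i,j)$ is an edge and $a_{ij}=0$ otherwise; $\mathsf L=\mathsf D-\mathsf A$ is its Laplacian, where $\mathsf D$ is the diagonal matrix with entries $\sum_j a_{ij}$. The samples $\hat\xi^{\,1},\dots,\hat\xi^{\,N}\in\mathbb{R}^m$ are distributed among the agents: each sample is held by exactly one agent and each agent holds at least one; $v_k\in\{1,\dots,n\}$ is the agent holding $\hat\xi^{\,k}$. The function $f:\mathbb{R}^d\times\mathbb{R}^m\to\mathbb{R}$ is continuously differentiable; $x\mapsto f(x,\xi)$ is convex for every $\xi$; for every $x$, $\xi\mapsto f(x,\xi)$ is either convex or concave; and the set of $\xi\in\mathbb{R}^m$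 for which neither $\mathbf 1_d$ nor $-\mathbf 1_d$ is a direction of recession of $x\mapsto f(x,\xi)$ is dense in $\mathbb{R}^m$ (a vector $w$ is a direction of recession of a finite convex function $\phi$ if $\phi(x+\alpha w)\le\phi(x)$ for all $x$ and $\alpha\ge0$). Notation: $h(\lambda_{\mathrm v}):=\epsilon^2(\mathbf 1_n^\top\lambda_{\mathrm v})/n$; $g_k(x,\lambda,\xi):=f(x,\xi)-\lambda\|\xi-\hat\xi^{\,k}\|^2$; $x_{\mathrm v}=(x^1;\dots;x^n)$ with $x^i\in\mathbb{R}^d$ (so $(x_{\mathrm v})^i=x^i$); $\lambda_{\mathrm v}=(\lambda^1;\dots;\lambda^n)$ with $\lambda^i\in\mathbb{R}$; $\nu\in\mathbb{R}^n$; $\eta\in\mathbb{R}^{nd}$; $\{\xi^k\}=(\xi^1,\dots,\xi^N)$ with $\xi^k\in\mathbb{R}^m$; $$F(x_{\mathrm v},\lambda_{\mathrm v}):=h(\lambda_{\mathrm v})+\frac1N\sum_{k=1}^N\max_{\xi\in\mathbb{R}^m}g_k(x^{v_k},\lambda^{v_k},\xi)\in(-\infty,+\infty],$$ $$L_{\mathrm{aug}}(x_{\mathrm v},\lambda_{\mathrm v},\nu,\eta):=F(x_{\mathrm v},\lambda_{\mathrm v})+\nu^\top\mathsf L\lambda_{\mathrm v}+\eta^\top(\mathsf L\otimes\mathsf I_d)x_{\mathrm v}+\tfrac12x_{\mathrm v}^\top(\mathsf L\otimes\mathsf I_d)x_{\mathrm v}+\tfrac12\lambda_{\mathrm v}^\top\mathsf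 L\lambda_{\mathrm v},$$ $$\tilde L_{\mathrm{aug}}(x_{\mathrm v},\lambda_{\mathrm v},\nu,\eta,\{\xi^k\}):=h(\lambda_{\mathrm v})+\frac1N\sum_{k=1}^Ng_k(x^{v_k},\lambda^{v_k},\xi^k)+\nu^\top\mathsf L\lambda_{\mathrm v}+\eta^\top(\mathsf L\otimes\mathsf I_d)x_{\mathrm v}+\tfrac12x_{\mathrm v}^\top(\mathsf L\otimes\mathsf I_d)x_{\mathrm v}+\tfrac12\lambda_{\mathrm v}^\top\mathsf L\lambda_{\mathrm v}.$$ $\mathbf 1_n,\mathbf 0_n$ are the all-ones and zero vectors, $\mathsf I_d$ the identity, $\otimes$ the Kronecker product; vector inequalities are componentwise. The symbols $\min$ and $\max$ are read as infimum and supremum in the extended reals. Problem (D): minimize $F(x_{\mathrm v},\lambda_{\mathrm v})$ over $x_{\mathrm v}\in\mathbb{R}^{nd}$, $\lambda_{\mathrm v}\ge\mathbf 0_n$ subject to $\mathsf L\lambda_{\mathrm v}=\mathbf 0_n$ and $(\mathsf L\otimes\mathsf I_d)x_{\mathrm v}=\mathbf 0_{nd}$. Standing assumption: for problem (P), $\inf_{\lambda\ge0,\,x\in\mathbb{R}^d}\{\lambda\epsilon^2+\frac1N\sum_{k=1}^N\max_{\xi\in\mathbb{R}^m}g_k(x,\lambda,\xi)\}$, the set of $(\lambda,x)\in\mathbb{R}_{\ge0}\times\mathbb{R}^d$ at which the objective is finite has nonempty interior, and there exists a finite optimizer $(x^*,\lambda^* )$. A point $(p_*,q_* )\in\mathcal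 P\times\mathcal Q$ is a saddle point of $\Phi$ over $\mathcal P\times\mathcal Q$ if $\Phi(p_*,q)\le\Phi(p_*,q_* )\le\Phi(p,q_* )$ for all $p\in\mathcal P$, $q\in\mathcal Q$. For a closed convex set $\mathcal K$, $y\in\mathcal K$ and a vector $w$, $\Pi_{\mathcal K}(y,w):=\lim_{\delta\to0^+}\frac{\mathrm{proj}_{\mathcal K}(y+\delta w)-y}{\delta}$, where $\mathrm{proj}_{\mathcal K}$ is the Euclidean projection onto $\mathcal K$. The saddle-point dynamics (SP) is, with all gradients of $\tilde L_{\mathrm{aug}}$ evaluated at $(x_{\mathrm v},\lambda_{\mathrm v},\nu,\eta,\{\xi^k\})$, $$\frac{d}{dt}\begin{bmatrix}x_{\mathrm v}\\ \lambda_{\mathrm v}\end{bmatrix}=\Pi_{\mathcal C}\Bigl((x_{\mathrm v},\lambda_{\mathrm v}),\begin{bmatrix}-\nabla_{x_{\mathrm v}}\tilde L_{\mathrm{aug}}\\-\nabla_{\lambda_{\mathrm v}}\tilde L_{\mathrm{aug}}\end{bmatrix}\Bigr),\quad \frac{d\nu}{dt}=\nabla_\nu\tilde L_{\mathrm{aug}},\quad\frac{d\eta}{dt}=\nabla_\eta\tilde L_{\mathrm{aug}},\quad\frac{d\xi^k}{dt}=\nabla_{\xi^k}\tilde L_{\mathrm{aug}}\;\;(k=1,\dots,N).$$ Trajectories are Caratheodory solutions: absolutely continuous curves satisfying the equations for almost every time. *)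

theory Defs
  imports "HOL-Analysis.Analysis"
begin

subsection \<open>Graphs and block vectors\<close>

text \<open>
  Agents are the elements of a finite type \<open>'n\<close>, sample indices those of a finite type \<open>'N\<close>.
  Self-loops are not excluded: a diagonal entry of the adjacency matrix cancels in the Laplacian.
\<close>

definition weighted_graph :: "('n \<times> 'n) set \<Rightarrow> real^'n^'n \<Rightarrow> bool" where
  "weighted_graph E A \<longleftrightarrow> sym E \<and> transpose A = A \<and>
     (\<forall>i j. ((i, j) \<in> E \<longrightarrow> 0 < A $ i $ j) \<and> ((i, j) \<notin> E \<longrightarrow> A $ i $ j = 0))"

definition connected_graph :: "('n \<times> 'n) set \<Rightarrow> bool" where
  "connected_graph E \<longleftrightarrow> (\<forall>i j. (i, j) \<in> E\<^sup>*)"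

definition degree_matrix :: "real^'n^'n \<Rightarrow> real^'n^'n" where
  "degree_matrix A = (\<chi> i j. if i = j then (\<Sum>l\<in>UNIV. A $ i $ l) else 0)"

definition laplacian :: "real^'n^'n \<Rightarrow> real^'n^'n" where
  "laplacian A = degree_matrix A - A"

definition kronecker :: "real^'b^'a \<Rightarrow> real^'e^'c \<Rightarrow> real^('b::finite \<times> 'e::finite)^('a::finite \<times> 'c::finite)" where
  "kronecker M K = (\<chi> p q. M $ fst p $ fst q * K $ snd p $ snd q)"

text \<open>
  The stacked vector \<open>(x\<^sup>1; \<dots>; x\<^sup>n)\<close> of \<open>n\<close> vectors in \<open>\<real>\<^sup>d\<close> is indexed by \<open>'n \<times> 'd\<close>;
  \<open>block x i\<close> is its \<open>i\<close>-th block.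
\<close>

definition block :: "real^('n::finite \<times> 'd::finite) \<Rightarrow> 'n \<Rightarrow> real^'d" where
  "block x i = (\<chi> a. x $ (i, a))"


subsection \<open>Functions\<close>

definition continuously_differentiable ::
    "('a::real_normed_vector \<Rightarrow> 'b::real_normed_vector) \<Rightarrow> bool" where
  "continuously_differentiable \<phi> \<longleftrightarrow>
     (\<exists>\<phi>' :: 'a \<Rightarrow> 'a \<Rightarrow>\<^sub>L 'b. (\<forall>z. (\<phi> has_derivative blinfun_apply (\<phi>' z)) (at z)) \<and>
        continuous_on UNIV \<phi>')"

definition gradient :: "('a::real_inner \<Rightarrow> real) \<Rightarrow> 'a \<Rightarrow> 'a" where
  "gradient \<phi> z = (THE D. GDERIV \<phi> z :> D)"

definition recession_direction :: "('a::real_vector \<Rightarrow> real) \<Rightarrow> 'a \<Rightarrow> bool" where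
  "recession_direction \<phi> w \<longleftrightarrow> (\<forall>x. \<forall>\<alpha>\<ge>0. \<phi> (x + \<alpha> *\<^sub>R w) \<le> \<phi> x)"

definition strongly_concave :: "('a::real_normed_vector \<Rightarrow> real) \<Rightarrow> bool" where
  "strongly_concave \<phi> \<longleftrightarrow> (\<exists>c>0. \<forall>y z. \<forall>t\<in>{0..1}.
     (1 - t) * \<phi> y + t * \<phi> z + c / 2 * t * (1 - t) * (norm (y - z))\<^sup>2
       \<le> \<phi> ((1 - t) *\<^sub>R y + t *\<^sub>R z))"

definition saddle_point ::
    "'p set \<Rightarrow> 'q set \<Rightarrow> ('p \<Rightarrow> 'q \<Rightarrow> 'r::order) \<Rightarrow> 'p \<Rightarrow> 'q \<Rightarrow> bool" where
  "saddle_point P Q \<Phi> p q \<longleftrightarrow> p \<in> P \<and> q \<in> Q \<and>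
     (\<forall>p'\<in>P. \<forall>q'\<in>Q. \<Phi> p q' \<le> \<Phi> p q \<and> \<Phi> p q \<le> \<Phi> p' q)"


subsection \<open>The distributionally robust problem\<close>

definition h :: "real \<Rightarrow> real^'n \<Rightarrow> real" where
  "h \<epsilon> l = \<epsilon>\<^sup>2 * (1 \<bullet> l) / real CARD('n)"

definition g :: "(real^'d \<Rightarrow> real^'m \<Rightarrow> real) \<Rightarrow> ('N \<Rightarrow> real^'m) \<Rightarrow> 'N
    \<Rightarrow> real^'d \<Rightarrow> real \<Rightarrow> real^'m \<Rightarrow> real" where
  "g f samp k x l \<xi> = f x \<xi> - l * (norm (\<xi> - samp k))\<^sup>2"

definition objective_P :: "(real^'d \<Rightarrow> real^'m \<Rightarrow> real) \<Rightarrow> ('N::finite \<Rightarrow> real^'m) \<Rightarrow> real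
    \<Rightarrow> real^'d \<Rightarrow> real \<Rightarrow> ereal" where
  "objective_P f samp \<epsilon> x l =
     ereal (l * \<epsilon>\<^sup>2) + ereal (1 / real CARD('N)) * (\<Sum>k\<in>UNIV. SUP \<xi>. ereal (g f samp k x l \<xi>))"

definition finite_set_P :: "(real^'d \<Rightarrow> real^'m \<Rightarrow> real) \<Rightarrow> ('N::finite \<Rightarrow> real^'m) \<Rightarrow> real
    \<Rightarrow> (real \<times> (real^'d)) set" where
  "finite_set_P f samp \<epsilon> = {(l, x). 0 \<le> l \<and> \<bar>objective_P f samp \<epsilon> x l\<bar> \<noteq> \<infinity>}"

definition optimizer_P :: "(real^'d \<Rightarrow> real^'m \<Rightarrow> real) \<Rightarrow> ('N::finite \<Rightarrow> real^'m) \<Rightarrow> real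
    \<Rightarrow> real^'d \<Rightarrow> real \<Rightarrow> bool" where
  "optimizer_P f samp \<epsilon> x l \<longleftrightarrow> 0 \<le> l \<and>
     (\<forall>x' l'. 0 \<le> l' \<longrightarrow> objective_P f samp \<epsilon> x l \<le> objective_P f samp \<epsilon> x' l')"

definition F :: "(real^'d \<Rightarrow> real^'m \<Rightarrow> real) \<Rightarrow> ('N::finite \<Rightarrow> real^'m) \<Rightarrow> real \<Rightarrow> ('N \<Rightarrow> 'n)
    \<Rightarrow> real^('n::finite \<times> 'd::finite) \<Rightarrow> real^'n \<Rightarrow> ereal" where
  "F f samp \<epsilon> v x l =
     ereal (h \<epsilon> l) + ereal (1 / real CARD('N)) *
       (\<Sum>k\<in>UNIV. SUP \<xi>. ereal (g f samp k (block x (v k)) (l $ v k) \<xi>))"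

definition feasible_D :: "real^'n^'n \<Rightarrow> ((real^('n::finite \<times> 'd::finite)) \<times> (real^'n)) set" where
  "feasible_D A = {(x, l). 0 \<le> l \<and> laplacian A *v l = 0 \<and>
     kronecker (laplacian A) (mat 1 :: real^'d^'d) *v x = 0}"

definition optimizer_D :: "(real^'d \<Rightarrow> real^'m \<Rightarrow> real) \<Rightarrow> ('N::finite \<Rightarrow> real^'m) \<Rightarrow> real
    \<Rightarrow> ('N \<Rightarrow> 'n) \<Rightarrow> real^'n^'n \<Rightarrow> real^('n::finite \<times> 'd::finite) \<Rightarrow> real^'n \<Rightarrow> bool" where
  "optimizer_D f samp \<epsilon> v A x l \<longleftrightarrow> (x, l) \<in> feasible_D A \<and>
     (\<forall>(x', l')\<in>feasible_D A. F f samp \<epsilon> v x l \<le> F f samp \<epsilon> v x' l')"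

definition consensus_terms :: "real^'n^'n \<Rightarrow> real^('n::finite \<times> 'd::finite) \<Rightarrow> real^'n \<Rightarrow> real^'n
    \<Rightarrow> real^('n::finite \<times> 'd::finite) \<Rightarrow> real" where
  "consensus_terms A x l \<nu> \<eta> = (let L = laplacian A; LI = kronecker L (mat 1 :: real^'d^'d) in
     \<nu> \<bullet> (L *v l) + \<eta> \<bullet> (LI *v x) + 1 / 2 * (x \<bullet> (LI *v x)) + 1 / 2 * (l \<bullet> (L *v l)))"

definition Laug :: "(real^'d \<Rightarrow> real^'m \<Rightarrow> real) \<Rightarrow> ('N::finite \<Rightarrow> real^'m) \<Rightarrow> real
    \<Rightarrow> ('N \<Rightarrow> 'n) \<Rightarrow> real^'n^'n
    \<Rightarrow> real^('n::finite \<times> 'd::finite) \<Rightarrow> real^'n \<Rightarrow> real^'n \<Rightarrow> real^('n::finite \<times> 'd::finite) \<Rightarrow> ereal" where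
  "Laug f samp \<epsilon> v A x l \<nu> \<eta> = F f samp \<epsilon> v x l + ereal (consensus_terms A x l \<nu> \<eta>)"

definition Laug_tilde :: "(real^'d \<Rightarrow> real^'m \<Rightarrow> real) \<Rightarrow> ('N::finite \<Rightarrow> real^'m) \<Rightarrow> real
    \<Rightarrow> ('N \<Rightarrow> 'n) \<Rightarrow> real^'n^'n
    \<Rightarrow> real^('n::finite \<times> 'd::finite) \<Rightarrow> real^'n \<Rightarrow> real^'n \<Rightarrow> real^('n::finite \<times> 'd::finite) \<Rightarrow> real^'m^'N \<Rightarrow> real" where
  "Laug_tilde f samp \<epsilon> v A x l \<nu> \<eta> \<xi> =
     h \<epsilon> l + 1 / real CARD('N) * (\<Sum>k\<in>UNIV. g f samp k (block x (v k)) (l $ v k) (\<xi> $ k))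
     + consensus_terms A x l \<nu> \<eta>"


subsection \<open>Saddle-point dynamics\<close>

text \<open>
  \<open>has_projected_vector K y w u\<close> says that the limit defining \<open>\<Pi>\<^sub>K(y, w)\<close> exists and equals \<open>u\<close>.
  For closed \<open>K\<close> and \<open>y \<notin> K\<close> the difference quotients are unbounded, so no such \<open>u\<close> exists.
\<close>

definition has_projected_vector :: "'a::euclidean_space set \<Rightarrow> 'a \<Rightarrow> 'a \<Rightarrow> 'a \<Rightarrow> bool" where
  "has_projected_vector K y w u \<longleftrightarrow>
     ((\<lambda>\<delta>. (closest_point K (y + \<delta> *\<^sub>R w) - y) /\<^sub>R \<delta>) \<longlongrightarrow> u) (at_right 0)"

definition abs_continuous_on_interval :: "real \<Rightarrow> real \<Rightarrow> (real \<Rightarrow> 'a::metric_space) \<Rightarrow> bool" where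
  "abs_continuous_on_interval a b \<gamma> \<longleftrightarrow> (\<forall>e>0. \<exists>\<delta>>0. \<forall>S :: (real \<times> real) set.
     finite S \<and> (\<forall>(s, t)\<in>S. a \<le> s \<and> s \<le> t \<and> t \<le> b) \<and>
     pairwise (\<lambda>I J. disjnt {fst I<..<snd I} {fst J<..<snd J}) S \<and>
     (\<Sum>(s, t)\<in>S. t - s) < \<delta>
     \<longrightarrow> (\<Sum>(s, t)\<in>S. dist (\<gamma> s) (\<gamma> t)) < e)"

text \<open>
  Caratheodory solutions on \<open>[0, \<infinity>)\<close>, absolutely continuous on each compact subinterval.
  The values of the curves at negative times are irrelevant.
\<close>

definition SP_trajectory :: "(real^'d \<Rightarrow> real^'m \<Rightarrow> real) \<Rightarrow> ('N::finite \<Rightarrow> real^'m) \<Rightarrow> real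
    \<Rightarrow> ('N \<Rightarrow> 'n) \<Rightarrow> real^'n^'n \<Rightarrow> ((real^('n::finite \<times> 'd::finite)) \<times> (real^'n)) set
    \<Rightarrow> (real \<Rightarrow> real^('n::finite \<times> 'd::finite)) \<Rightarrow> (real \<Rightarrow> real^'n) \<Rightarrow> (real \<Rightarrow> real^'n)
    \<Rightarrow> (real \<Rightarrow> real^('n::finite \<times> 'd::finite)) \<Rightarrow> (real \<Rightarrow> real^'m^'N) \<Rightarrow> bool" where
  "SP_trajectory f samp \<epsilon> v A C x l \<nu> \<eta> \<xi> \<longleftrightarrow>
     (let Lt = Laug_tilde f samp \<epsilon> v A in
      (\<forall>T\<ge>0. abs_continuous_on_interval 0 T (\<lambda>t. (x t, l t, \<nu> t, \<eta> t, \<xi> t))) \<and>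
      (AE t in lborel. 0 \<le> t \<longrightarrow>
        (\<exists>u. has_projected_vector C (x t, l t)
               (- gradient (\<lambda>y. Lt y (l t) (\<nu> t) (\<eta> t) (\<xi> t)) (x t),
                - gradient (\<lambda>y. Lt (x t) y (\<nu> t) (\<eta> t) (\<xi> t)) (l t)) u \<and>
             ((\<lambda>s. (x s, l s)) has_vector_derivative u) (at t within {0..})) \<and>
        (\<nu> has_vector_derivative
           gradient (\<lambda>y. Lt (x t) (l t) y (\<eta> t) (\<xi> t)) (\<nu> t)) (at t within {0..}) \<and>
        (\<eta> has_vector_derivative
           gradient (\<lambda>y. Lt (x t) (l t) (\<nu> t) y (\<xi> t)) (\<eta> t)) (at t within {0..}) \<and>
        (\<forall>k. ((\<lambda>s. \<xi> s $ k) has_vector_derivative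
           gradient (\<lambda>y. Lt (x t) (l t) (\<nu> t) (\<eta> t) (\<chi> j. if j = k then y else \<xi> t $ j)) (\<xi> t $ k))
           (at t within {0..}))))"

end

theory Submission
  imports Defs
begin

text \<open>
  Write \<open>p = (x, l)\<close>, \<open>m = (\<eta>, \<nu>)\<close>, \<open>z = \<xi>\<close>. The augmented Lagrangian becomes
  \<open>L p m z = \<Phi> p z + m \<bullet> B p + 1/2 * (p \<bullet> B p)\<close> with \<open>B\<close> the symmetric positive semidefinite
  Laplacian map and \<open>\<Phi>\<close> convex in \<open>p\<close> on the whole space. Along a trajectory, half the squared distance
  to the given saddle point decreases at rate at least \<open>W = L p ms zs - L ps m z\<close>, and
  \<open>W \<ge> 1/2 * (p \<bullet> B p) + \<kappa> * |z - zs|^2\<close> by interiority of \<open>ps\<close> and strong concavity. Since \<open>W\<close> is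
  uniformly continuous in time it tends to \<open>0\<close>, so \<open>B p\<close> tends to \<open>0\<close>, \<open>z\<close> tends to \<open>zs\<close>, and \<open>L\<close>
  tends to the saddle value. Instead of LaSalle's invariance principle (which would need well-posedness of
  the projected flow), the dissipation inequalities are integrated over time windows on which the dual
  variables hardly move: long windows show that every limit point minimizes \<open>L\<close> over \<open>C\<close> in the primal
  variable, short ones that it maximizes \<open>L\<close> in the dual variable. A limit point is thus a saddle point, and
  the distance to it decreases as well, which gives convergence. All saddle values agree, and the given
  saddle point minimizes \<open>L\<close> over all primal variables, not only over \<open>C\<close>; this yields optimality for (D).
\<close>

subsection \<open>Absolutely continuous curves\<close>

text \<open>\<open>W\<close> sees a trajectory only through \<open>B p\<close>, \<open>z\<close> and
  the value of \<open>L\<close> at the given duals \<open>(ms, zs)\<close>. Its decay alone does not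
  tell whether a limit \<open>mb\<close> of the multipliers is optimal, nor whether
  \<open>zs\<close> still maximizes \<Phi> at a limit point of \<open>p\<close>; the time windows
  close this gap. Their lengths differ for a reason. Optimality of \<open>mb\<close> involves the
  multipliers, whose velocity \<open>B p\<close> tends to 0, so windows of any length are available
  late enough. Maximality of \<open>zs\<close> involves \<open>p\<close>, whose velocity is only
  known to be bounded, so the window must be short; there the known convergence of \<open>z\<close>
  makes up for the small gain.

  The lower bound for \<open>W\<close> rests on comparing orders: along a segment from the interior
  minimizer \<open>ps\<close>, the augmentation is of second order, so the convex remainder is
  already minimal at \<open>ps\<close> and the augmentation survives in full as a surplus.

  Curves are only absolutely continuous, so every estimate is put in the form "a derivative bound
  almost everywhere gives a bound on an increment", obtained from gauge divisions without
  integrating the derivative.\<close>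

lemma abs_continuous_on_interval_subset:
  assumes "abs_continuous_on_interval a b \<gamma>" "a \<le> a'" "b' \<le> b"
  shows "abs_continuous_on_interval a' b' \<gamma>"
  unfolding abs_continuous_on_interval_def
proof (intro allI impI)
  fix e :: real assume "e > 0"
  then obtain \<delta> where "\<delta> > 0" and \<delta>: "\<And>S :: (real \<times> real) set.
     finite S \<and> (\<forall>(s, t)\<in>S. a \<le> s \<and> s \<le> t \<and> t \<le> b) \<and>
     pairwise (\<lambda>I J. disjnt {fst I<..<snd I} {fst J<..<snd J}) S \<and>
     (\<Sum>(s, t)\<in>S. t - s) < \<delta> \<Longrightarrow> (\<Sum>(s, t)\<in>S. dist (\<gamma> s) (\<gamma> t)) < e"
    using assms(1) unfolding abs_continuous_on_interval_def by meson
  show "\<exists>\<delta>>0. \<forall>S :: (real \<times> real) set.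
     finite S \<and> (\<forall>(s, t)\<in>S. a' \<le> s \<and> s \<le> t \<and> t \<le> b') \<and>
     pairwise (\<lambda>I J. disjnt {fst I<..<snd I} {fst J<..<snd J}) S \<and>
     (\<Sum>(s, t)\<in>S. t - s) < \<delta> \<longrightarrow> (\<Sum>(s, t)\<in>S. dist (\<gamma> s) (\<gamma> t)) < e"
  proof (intro exI conjI allI impI)
    fix S :: "(real \<times> real) set"
    assume S: "finite S \<and> (\<forall>(s, t)\<in>S. a' \<le> s \<and> s \<le> t \<and> t \<le> b') \<and>
     pairwise (\<lambda>I J. disjnt {fst I<..<snd I} {fst J<..<snd J}) S \<and>
     (\<Sum>(s, t)\<in>S. t - s) < \<delta>"
    with assms(2,3) show "(\<Sum>(s, t)\<in>S. dist (\<gamma> s) (\<gamma> t)) < e"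
      by (intro \<delta>) (auto dest!: bspec)
  qed fact
qed

text \<open>Only sums of distances enter the definition, so they scale by the constant. The
  Lipschitz bound is required along the curve only, which admits squared distances, Lipschitz on the
  bounded range of \<gamma>.\<close>

lemma abs_continuous_on_interval_lipschitz_compose:
  assumes ac: "abs_continuous_on_interval a b \<gamma>"
    and lip: "\<And>s t. s \<in> {a..b} \<Longrightarrow> t \<in> {a..b} \<Longrightarrow> dist (\<phi> s) (\<phi> t) \<le> K * dist (\<gamma> s) (\<gamma> t)"
  shows "abs_continuous_on_interval a b \<phi>"
  unfolding abs_continuous_on_interval_def
proof (intro allI impI)
  fix e :: real assume "e > 0"
  \<comment> \<open>A positive constant above \<open>K\<close>, whose sign is unknown, so that
    \<open>e / M\<close> makes sense.\<close>
  define M where "M = \<bar>K\<bar> + 1"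
  have "M > 0" by (simp add: M_def)
  then have "e / M > 0" using \<open>e > 0\<close> by simp
  then obtain \<delta> where "\<delta> > 0" and \<delta>: "\<And>S :: (real \<times> real) set.
     finite S \<and> (\<forall>(s, t)\<in>S. a \<le> s \<and> s \<le> t \<and> t \<le> b) \<and>
     pairwise (\<lambda>I J. disjnt {fst I<..<snd I} {fst J<..<snd J}) S \<and>
     (\<Sum>(s, t)\<in>S. t - s) < \<delta> \<Longrightarrow> (\<Sum>(s, t)\<in>S. dist (\<gamma> s) (\<gamma> t)) < e / M"
    using ac unfolding abs_continuous_on_interval_def by meson
  show "\<exists>\<delta>>0. \<forall>S :: (real \<times> real) set.
     finite S \<and> (\<forall>(s, t)\<in>S. a \<le> s \<and> s \<le> t \<and> t \<le> b) \<and>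
     pairwise (\<lambda>I J. disjnt {fst I<..<snd I} {fst J<..<snd J}) S \<and>
     (\<Sum>(s, t)\<in>S. t - s) < \<delta> \<longrightarrow> (\<Sum>(s, t)\<in>S. dist (\<phi> s) (\<phi> t)) < e"
  proof (intro exI conjI allI impI)
    fix S :: "(real \<times> real) set"
    assume S: "finite S \<and> (\<forall>(s, t)\<in>S. a \<le> s \<and> s \<le> t \<and> t \<le> b) \<and>
     pairwise (\<lambda>I J. disjnt {fst I<..<snd I} {fst J<..<snd J}) S \<and>
     (\<Sum>(s, t)\<in>S. t - s) < \<delta>"
    have "(\<Sum>(s, t)\<in>S. dist (\<phi> s) (\<phi> t)) \<le> (\<Sum>(s, t)\<in>S. M * dist (\<gamma> s) (\<gamma> t))"
    proof (rule sum_mono, clarify)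
      fix s t assume "(s, t) \<in> S"
      then have "s \<in> {a..b}" "t \<in> {a..b}" using S by (auto dest!: bspec)
      then have "dist (\<phi> s) (\<phi> t) \<le> K * dist (\<gamma> s) (\<gamma> t)" by (rule lip)
      also have "\<dots> \<le> M * dist (\<gamma> s) (\<gamma> t)"
        by (rule mult_right_mono) (auto simp: M_def)
      finally show "dist (\<phi> s) (\<phi> t) \<le> M * dist (\<gamma> s) (\<gamma> t)" .
    qed
    also have "\<dots> = M * (\<Sum>(s, t)\<in>S. dist (\<gamma> s) (\<gamma> t))"
      by (simp add: sum_distrib_left case_prod_unfold)
    also have "\<dots> < e"
      using \<delta>[OF S] \<open>M > 0\<close> by (simp add: field_simps)
    finally show "(\<Sum>(s, t)\<in>S. dist (\<phi> s) (\<phi> t)) < e" .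
  qed fact
qed

lemma abs_continuous_on_interval_imp_continuous_on:
  assumes "abs_continuous_on_interval a b \<gamma>"
  shows "continuous_on {a..b} \<gamma>"
  unfolding continuous_on_iff
proof (intro ballI allI impI)
  fix t e :: real assume "t \<in> {a..b}" "e > 0"
  then obtain \<delta> where "\<delta> > 0" and \<delta>: "\<And>S :: (real \<times> real) set.
     finite S \<and> (\<forall>(s, t)\<in>S. a \<le> s \<and> s \<le> t \<and> t \<le> b) \<and>
     pairwise (\<lambda>I J. disjnt {fst I<..<snd I} {fst J<..<snd J}) S \<and>
     (\<Sum>(s, t)\<in>S. t - s) < \<delta> \<Longrightarrow> (\<Sum>(s, t)\<in>S. dist (\<gamma> s) (\<gamma> t)) < e"
    using assms unfolding abs_continuous_on_interval_def by meson
  show "\<exists>d>0. \<forall>s\<in>{a..b}. dist s t < d \<longrightarrow> dist (\<gamma> s) (\<gamma> t) < e"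
  proof (intro exI conjI ballI impI)
    fix s assume s: "s \<in> {a..b}" "dist s t < \<delta>"
    \<comment> \<open>A collection of a single interval, with its endpoints put in order.\<close>
    have "(\<Sum>(s, t)\<in>{(min s t, max s t)}. dist (\<gamma> s) (\<gamma> t)) < e"
      by (rule \<delta>) (use s \<open>t \<in> {a..b}\<close> in \<open>auto simp: dist_real_def min_def max_def\<close>)
    then show "dist (\<gamma> s) (\<gamma> t) < e"
      by (auto simp: min_def max_def dist_commute split: if_splits)
  qed fact
qed

section \<open>Increment bounds from derivatives that exist almost everywhere\<close>

lemma null_set_outer_open:
  fixes N :: "'a::euclidean_space set"
  assumes "N \<in> null_sets lborel" "\<delta> > 0"
  obtains U where "open U" "N \<subseteq> U" "U \<in> lmeasurable" "measure lebesgue U < \<delta>"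
proof -
  have N: "N \<in> null_sets lebesgue" using assms(1) by (rule null_sets_completionI)
  then obtain U where U: "open U" "N \<subseteq> U" "U - N \<in> lmeasurable" "emeasure lebesgue (U - N) < ennreal \<delta>"
    using sets_lebesgue_outer_open[of N \<delta>] \<open>\<delta> > 0\<close> by (auto dest: null_setsD2)
  have eq: "U = (U - N) \<union> N" using U(2) by auto
  have Un: "emeasure lebesgue ((U - N) \<union> N) = emeasure lebesgue (U - N)"
    using N U(3) by (intro emeasure_Un_null_set) auto
  have "U \<in> lmeasurable"
    by (subst eq, rule fmeasurable.Un) (use U(3) N negligible_iff_null_sets negligible_imp_measurable in auto)
  moreover have "measure lebesgue U < \<delta>"
    using U(4) Un \<open>\<delta> > 0\<close> unfolding eq[symmetric]
    by (metis calculation emeasure_eq_measure2 ennreal_less_iff measure_nonneg)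
  ultimately show thesis using that U by blast
qed

text \<open>A gauge division telescopes \<open>u b - u a\<close>. Intervals whose tag has a
  derivative contribute at most \<open>e\<close> times their length. The remaining nondegenerate
  ones have total length below the \<delta> of absolute continuity and contribute less than
  \<open>e\<close> altogether.\<close>

lemma abs_continuous_on_interval_nonincreasing:
  fixes u :: "real \<Rightarrow> real"
  assumes "a \<le> b" and ac: "abs_continuous_on_interval a b u"
    and ae: "AE t in lborel. a \<le> t \<and> t \<le> b \<longrightarrow> (\<exists>D\<le>0. (u has_vector_derivative D) (at t within {a..b}))"
  shows "u b \<le> u a"
proof (rule field_le_epsilon)
  fix e' :: real assume "e' > 0"
  \<comment> \<open>The two groups of intervals will contribute \<open>e\<close> and
    \<open>e * (b - a)\<close>, which add up to \<open>e'\<close>.\<close>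
  define e where "e = e' / (b - a + 1)"
  have "e > 0" using \<open>e' > 0\<close> \<open>a \<le> b\<close> by (simp add: e_def)
  obtain \<delta> where "\<delta> > 0" and \<delta>: "\<And>S :: (real \<times> real) set.
     finite S \<and> (\<forall>(s, t)\<in>S. a \<le> s \<and> s \<le> t \<and> t \<le> b) \<and>
     pairwise (\<lambda>I J. disjnt {fst I<..<snd I} {fst J<..<snd J}) S \<and>
     (\<Sum>(s, t)\<in>S. t - s) < \<delta> \<Longrightarrow> (\<Sum>(s, t)\<in>S. dist (u s) (u t)) < e"
    using ac \<open>e > 0\<close> unfolding abs_continuous_on_interval_def by meson
  obtain N where N: "N \<in> null_sets lborel"
    and good: "\<And>t. t \<in> {a..b} \<Longrightarrow> t \<notin> N \<Longrightarrow> \<exists>D\<le>0. (u has_vector_derivative D) (at t within {a..b})"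
  proof -
    obtain N where "N \<in> null_sets lborel"
      and sub: "{t \<in> space lborel. \<not> (a \<le> t \<and> t \<le> b \<longrightarrow> (\<exists>D\<le>0. (u has_vector_derivative D) (at t within {a..b})))} \<subseteq> N"
      using ae unfolding eventually_ae_filter by auto
    moreover have "\<exists>D\<le>0. (u has_vector_derivative D) (at t within {a..b})"
      if "t \<in> {a..b}" "t \<notin> N" for t
      using that subsetD[OF sub, of t] by auto
    ultimately show thesis using that by blast
  qed
  obtain U where U: "open U" "N \<subseteq> U" "U \<in> lmeasurable" "measure lebesgue U < \<delta>"
    using null_set_outer_open[OF N \<open>\<delta> > 0\<close>] .
  \<comment> \<open>Straddle estimate: the interval must contain \<open>t\<close>, so that the
    linearization errors at its two ends add up to at most \<open>e * (r - s)\<close>.\<close>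
  have "\<exists>d>0. \<forall>s r. a \<le> s \<longrightarrow> s \<le> t \<longrightarrow> t \<le> r \<longrightarrow> r \<le> b \<longrightarrow> t - d < s \<longrightarrow> r < t + d \<longrightarrow> u r - u s \<le> e * (r - s)"
    if t: "t \<in> {a..b}" "t \<notin> N" for t
  proof -
    obtain D where "D \<le> 0" and "(u has_vector_derivative D) (at t within {a..b})"
      using good[OF t] by auto
    then obtain d where "d > 0" and d: "\<And>s. s \<in> {a..b} \<Longrightarrow> \<bar>s - t\<bar> < d \<Longrightarrow> \<bar>u s - u t - (s - t) * D\<bar> \<le> e * \<bar>s - t\<bar>"
      using \<open>e > 0\<close> unfolding has_vector_derivative_def has_derivative_within_alt
      by (metis real_norm_def real_scaleR_def)
    show ?thesis
    proof (intro exI conjI allI impI)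
      fix s r assume *: "a \<le> s" "s \<le> t" "t \<le> r" "r \<le> b" "t - d < s" "r < t + d"
      have "\<bar>u s - u t - (s - t) * D\<bar> \<le> e * \<bar>s - t\<bar>" by (rule d) (use * in auto)
      moreover have "\<bar>u r - u t - (r - t) * D\<bar> \<le> e * \<bar>r - t\<bar>" by (rule d) (use * in auto)
      moreover have "(r - t) * D \<le> 0" "(s - t) * D \<ge> 0"
        using * \<open>D \<le> 0\<close> by (auto simp: mult_nonneg_nonpos mult_nonpos_nonpos)
      moreover have "e * \<bar>s - t\<bar> = e * (t - s)" "e * \<bar>r - t\<bar> = e * (r - t)" using * by auto
      ultimately show "u r - u s \<le> e * (r - s)" by (simp add: algebra_simps)
    qed fact
  qed
  then obtain d where dpos: "\<And>t. t \<in> {a..b} \<Longrightarrow> t \<notin> N \<Longrightarrow> d t > (0::real)"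
    and d: "\<And>t s r. t \<in> {a..b} \<Longrightarrow> t \<notin> N \<Longrightarrow> a \<le> s \<Longrightarrow> s \<le> t \<Longrightarrow> t \<le> r \<Longrightarrow> r \<le> b \<Longrightarrow>
      t - d t < s \<Longrightarrow> r < t + d t \<Longrightarrow> u r - u s \<le> e * (r - s)"
    by metis
  \<comment> \<open>In a \<open>G\<close>-fine division, the intervals tagged in \<open>N\<close> lie in \<open>U\<close>, so absolute continuity controls them;
    on the others the derivative does.\<close>
  define G where "G t = (if t \<in> N then U else if t \<in> {a..b} then ball t (d t) else UNIV)" for t
  have "gauge G" using U dpos by (auto simp: gauge_def G_def)
  then obtain P where P: "P tagged_division_of {a..b}" and fine: "G fine P"
    by (rule fine_division_exists_real)
  have finP: "finite P" using P by auto
  have intv: "\<exists>s r. K = {s..r} \<and> s \<le> r \<and> a \<le> s \<and> r \<le> b \<and> s \<le> t \<and> t \<le> r"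
    if tK: "(t, K) \<in> P" for t K
  proof -
    obtain s r where K: "K = {s..r}" using tagged_division_ofD(4)[OF P tK] by auto
    moreover have "t \<in> K" "K \<subseteq> {a..b}" using P tK by auto
    ultimately show ?thesis by (intro exI[of _ s] exI[of _ r]) auto
  qed
  \<comment> \<open>Degenerate intervals are left out: they contribute nothing, and without them
    distinct members have distinct endpoint pairs, which makes \<open>ends\<close>
    injective.\<close>
  define B where "B = {(t, K) \<in> P. t \<in> N \<and> Inf K < Sup K}"
  define ends where "ends = (\<lambda>(t :: real, K :: real set). (Inf K, Sup K))"
  have BP: "B \<subseteq> P" by (auto simp: B_def)
  have finB: "finite B" using finP BP by (rule finite_subset[rotated])
  have int_ends: "interior (snd i) = {Inf (snd i)<..<Sup (snd i)}" if iP: "i \<in> P" for i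
  proof -
    obtain s r where "snd i = {s..r}" "s \<le> r" using intv[of "fst i" "snd i"] iP by auto
    then show ?thesis by (simp add: interior_atLeastAtMost_real)
  qed
  have disj: "{Inf (snd i)<..<Sup (snd i)} \<inter> {Inf (snd j)<..<Sup (snd j)} = {}"
    if "i \<in> P" "j \<in> P" "i \<noteq> j" for i j
    using tagged_division_ofD(5)[OF P, of "fst i" "snd i" "fst j" "snd j"] that int_ends by auto
  have inj: "inj_on ends B"
  proof (rule inj_onI, rule ccontr)
    fix i j assume ij: "i \<in> B" "j \<in> B" "ends i = ends j" "i \<noteq> j"
    then have "{Inf (snd i)<..<Sup (snd i)} = {}"
      using disj[of i j] BP by (auto simp: ends_def split: prod.splits)
    moreover have "Inf (snd i) < Sup (snd i)" using ij by (auto simp: B_def)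
    ultimately show False by simp
  qed
  have "(\<Sum>(s, t)\<in>ends ` B. dist (u s) (u t)) < e"
  proof (rule \<delta>, intro conjI)
    show "finite (ends ` B)" using finB by simp
    show "\<forall>(s, t)\<in>ends ` B. a \<le> s \<and> s \<le> t \<and> t \<le> b"
    proof (clarsimp simp: ends_def)
      fix s r t K assume "(t, K) \<in> B"
      then show "a \<le> Inf K \<and> Inf K \<le> Sup K \<and> Sup K \<le> b"
        using intv[of t K] subsetD[OF BP, of "(t, K)"] by auto
    qed
    show "pairwise (\<lambda>I J. disjnt {fst I<..<snd I} {fst J<..<snd J}) (ends ` B)"
      unfolding pairwise_def disjnt_def
    proof (intro ballI impI)
      fix I J assume "I \<in> ends ` B" "J \<in> ends ` B" "I \<noteq> J"
      then obtain i j where "i \<in> B" "j \<in> B" "I = ends i" "J = ends j" "i \<noteq> j" by blast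
      then show "{fst I<..<snd I} \<inter> {fst J<..<snd J} = {}"
        using disj[of i j] BP by (auto simp: ends_def split: prod.splits)
    qed
    have "(\<Sum>(s, t)\<in>ends ` B. t - s) = (\<Sum>i\<in>B. Sup (snd i) - Inf (snd i))"
      by (subst sum.reindex[OF inj]) (auto simp: ends_def intro!: sum.cong)
    also have "\<dots> = (\<Sum>i\<in>B. measure lebesgue {Inf (snd i)<..<Sup (snd i)})"
      by (rule sum.cong) (auto simp: B_def)
    also have "\<dots> = measure lebesgue (\<Union>i\<in>B. {Inf (snd i)<..<Sup (snd i)})"
    proof (rule measure_finite_Union[symmetric])
      show "disjoint_family_on (\<lambda>i. {Inf (snd i)<..<Sup (snd i)}) B"
        unfolding disjoint_family_on_def using disj BP by blast
    qed (use finB in \<open>auto simp: B_def\<close>)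
    also have "\<dots> \<le> measure lebesgue U"
    proof (rule measure_mono_fmeasurable)
      show "(\<Union>i\<in>B. {Inf (snd i)<..<Sup (snd i)}) \<subseteq> U"
      proof safe
        fix t K x assume i: "(t, K) \<in> B" and x: "x \<in> {Inf (snd (t, K))<..<Sup (snd (t, K))}"
        then have "K \<subseteq> G t" using fine BP by (auto simp: fine_def)
        then have "K \<subseteq> U" using i by (auto simp: G_def B_def)
        moreover have "x \<in> K" using int_ends[OF subsetD[OF BP i]] x interior_subset[of K] by auto
        ultimately show "x \<in> U" by auto
      qed
      show "(\<Union>i\<in>B. {Inf (snd i)<..<Sup (snd i)}) \<in> sets lebesgue"
        by (rule sets_completionI_sets) (use finB in \<open>auto intro!: sets.countable_UN' countable_finite\<close>)
    qed (use U in auto)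
    finally show "(\<Sum>(s, t)\<in>ends ` B. t - s) < \<delta>" using U by simp
  qed
  then have bad: "(\<Sum>(t, K)\<in>B. dist (u (Inf K)) (u (Sup K))) < e"
    by (subst (asm) sum.reindex[OF inj]) (auto simp: ends_def case_prod_unfold)
  have "u b - u a = (\<Sum>(t, K)\<in>P. u (Sup K) - u (Inf K))"
    using additive_tagged_division_1[OF \<open>a \<le> b\<close> P, of u] by simp
  also have "\<dots> = (\<Sum>(t, K)\<in>B. u (Sup K) - u (Inf K)) + (\<Sum>(t, K)\<in>P - B. u (Sup K) - u (Inf K))"
    by (rule sum.subset_diff[OF BP finP, THEN trans]) simp
  also have "(\<Sum>(t, K)\<in>B. u (Sup K) - u (Inf K)) \<le> (\<Sum>(t, K)\<in>B. dist (u (Inf K)) (u (Sup K)))"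
    by (rule sum_mono) (auto simp: dist_real_def)
  also have "(\<Sum>(t, K)\<in>P - B. u (Sup K) - u (Inf K)) \<le> (\<Sum>(t, K)\<in>P - B. e * (Sup K - Inf K))"
  proof (rule sum_mono, clarify)
    fix t K assume tK: "(t, K) \<in> P" "(t, K) \<notin> B"
    then obtain s r where K: "K = {s..r}" "s \<le> r" "a \<le> s" "r \<le> b" "s \<le> t" "t \<le> r" using intv by blast
    show "u (Sup K) - u (Inf K) \<le> e * (Sup K - Inf K)"
    proof (cases "t \<in> N")
      case True
      then show ?thesis using tK K by (auto simp: B_def)
    next
      case False
      have t: "t \<in> {a..b}" using K by auto
      have "K \<subseteq> ball t (d t)" using fine tK False t unfolding fine_def G_def by fastforce
      moreover have "s \<in> K" "r \<in> K" using K by auto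
      ultimately have "s \<in> ball t (d t)" "r \<in> ball t (d t)" by blast+
      then have "u r - u s \<le> e * (r - s)"
        using K False t by (intro d[of t]) (auto simp: dist_real_def)
      then show ?thesis using K by simp
    qed
  qed
  also have "\<dots> \<le> (\<Sum>(t, K)\<in>P. e * (Sup K - Inf K))"
  proof (rule sum_mono2)
    fix i assume "i \<in> P - (P - B)"
    then show "0 \<le> (case i of (t, K) \<Rightarrow> e * (Sup K - Inf K))"
      using \<open>e > 0\<close> by (auto simp: B_def)
  qed (use finP in auto)
  also have "\<dots> = e * (b - a)"
    using additive_tagged_division_1[OF \<open>a \<le> b\<close> P, of "\<lambda>t. t"]
    by (simp add: sum_distrib_left[symmetric] case_prod_unfold)
  finally have "u b - u a \<le> e + e * (b - a)" using bad by simp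
  also have "e + e * (b - a) = e * (b - a + 1)" by (simp add: algebra_simps)
  also have "\<dots> = e'" using \<open>a \<le> b\<close> by (simp add: e_def)
  finally show "u b \<le> u a + e'" by simp
qed

text \<open>Subtracting the line \<open>c * t\<close> reduces the claim to a nonpositive derivative;
  the subtracted line costs at most \<open>\<bar>c\<bar>\<close> times the total length in the
  absolute continuity estimate.\<close>

lemma abs_continuous_on_interval_increment_le:
  fixes u :: "real \<Rightarrow> real"
  assumes "a \<le> b" and ac: "abs_continuous_on_interval a b u"
    and ae: "AE t in lborel. a \<le> t \<and> t \<le> b \<longrightarrow> (\<exists>D\<le>c. (u has_vector_derivative D) (at t within {a..b}))"
  shows "u b - u a \<le> c * (b - a)"
proof -
  define w where "w t = u t - c * t" for t
  have "abs_continuous_on_interval a b w"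
    unfolding abs_continuous_on_interval_def
  proof (intro allI impI)
    fix e :: real assume "e > 0"
    then have "e / 2 > 0" by simp
    then obtain \<delta> where "\<delta> > 0" and \<delta>: "\<And>S :: (real \<times> real) set.
       finite S \<and> (\<forall>(s, t)\<in>S. a \<le> s \<and> s \<le> t \<and> t \<le> b) \<and>
       pairwise (\<lambda>I J. disjnt {fst I<..<snd I} {fst J<..<snd J}) S \<and>
       (\<Sum>(s, t)\<in>S. t - s) < \<delta> \<Longrightarrow> (\<Sum>(s, t)\<in>S. dist (u s) (u t)) < e / 2"
      using ac unfolding abs_continuous_on_interval_def by meson
    define \<delta>' where "\<delta>' = min \<delta> (e / (2 * (\<bar>c\<bar> + 1)))"
    show "\<exists>\<delta>>0. \<forall>S :: (real \<times> real) set.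
       finite S \<and> (\<forall>(s, t)\<in>S. a \<le> s \<and> s \<le> t \<and> t \<le> b) \<and>
       pairwise (\<lambda>I J. disjnt {fst I<..<snd I} {fst J<..<snd J}) S \<and>
       (\<Sum>(s, t)\<in>S. t - s) < \<delta> \<longrightarrow> (\<Sum>(s, t)\<in>S. dist (w s) (w t)) < e"
    proof (intro exI conjI allI impI)
      show "\<delta>' > 0" using \<open>\<delta> > 0\<close> \<open>e > 0\<close> by (simp add: \<delta>'_def)
      fix S :: "(real \<times> real) set"
      assume S: "finite S \<and> (\<forall>(s, t)\<in>S. a \<le> s \<and> s \<le> t \<and> t \<le> b) \<and>
       pairwise (\<lambda>I J. disjnt {fst I<..<snd I} {fst J<..<snd J}) S \<and>
       (\<Sum>(s, t)\<in>S. t - s) < \<delta>'"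
      have "(\<Sum>(s, t)\<in>S. dist (w s) (w t)) \<le> (\<Sum>(s, t)\<in>S. dist (u s) (u t) + (\<bar>c\<bar> + 1) * (t - s))"
      proof (rule sum_mono, clarify)
        fix s t assume "(s, t) \<in> S"
        then have "s \<le> t" using S by (auto dest!: bspec)
        then have "\<bar>c * s - c * t\<bar> \<le> (\<bar>c\<bar> + 1) * (t - s)"
          unfolding right_diff_distrib[symmetric] abs_mult by (intro mult_mono) auto
        then show "dist (w s) (w t) \<le> dist (u s) (u t) + (\<bar>c\<bar> + 1) * (t - s)"
          by (simp add: w_def dist_real_def)
      qed
      also have "\<dots> = (\<Sum>(s, t)\<in>S. dist (u s) (u t)) + (\<bar>c\<bar> + 1) * (\<Sum>(s, t)\<in>S. t - s)"
        by (simp add: sum.distrib sum_distrib_left case_prod_unfold)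
      also have "\<dots> < e / 2 + e / 2"
      proof (rule add_strict_mono)
        show "(\<Sum>(s, t)\<in>S. dist (u s) (u t)) < e / 2"
          using S by (intro \<delta>) (auto simp: \<delta>'_def)
        have "(\<Sum>(s, t)\<in>S. t - s) < e / (2 * (\<bar>c\<bar> + 1))" using S by (auto simp: \<delta>'_def)
        then have "(\<bar>c\<bar> + 1) * (\<Sum>(s, t)\<in>S. t - s) < (\<bar>c\<bar> + 1) * (e / (2 * (\<bar>c\<bar> + 1)))"
          by (intro mult_strict_left_mono) auto
        also have "\<dots> = e / 2" by (simp add: field_simps add_nonneg_eq_0_iff)
        finally show "(\<bar>c\<bar> + 1) * (\<Sum>(s, t)\<in>S. t - s) < e / 2" .
      qed
      finally show "(\<Sum>(s, t)\<in>S. dist (w s) (w t)) < e" by simp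
    qed
  qed
  moreover have "AE t in lborel. a \<le> t \<and> t \<le> b \<longrightarrow> (\<exists>D\<le>0. (w has_vector_derivative D) (at t within {a..b}))"
    using ae
  proof eventually_elim
    case (elim t)
    show ?case
    proof
      assume "a \<le> t \<and> t \<le> b"
      then obtain D where D: "D \<le> c" "(u has_vector_derivative D) (at t within {a..b})" using elim by auto
      have "(w has_vector_derivative D - c) (at t within {a..b})"
        unfolding w_def by (rule has_vector_derivative_diff[OF D(2)]) (auto intro!: derivative_eq_intros simp: has_real_derivative_iff_has_vector_derivative[symmetric])
      then show "\<exists>D\<le>0. (w has_vector_derivative D) (at t within {a..b})" using D by (intro exI[of _ "D - c"]) auto
    qed
  qed
  ultimately have "w b \<le> w a" by (rule abs_continuous_on_interval_nonincreasing[OF \<open>a \<le> b\<close>])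
  then show ?thesis by (simp add: w_def algebra_simps)
qed

text \<open>Pairing the curve with its own total increment \<open>e\<close> makes the problem
  scalar: the increment of \<open>e \<bullet> \<gamma>\<close> is \<open>norm e\<close> squared, and
  its derivative is at most \<open>norm e * M\<close>.\<close>

lemma abs_continuous_on_interval_norm_increment_le:
  fixes \<gamma> :: "real \<Rightarrow> 'a::real_inner"
  assumes "a \<le> b" and ac: "abs_continuous_on_interval a b \<gamma>"
    and ae: "AE t in lborel. a \<le> t \<and> t \<le> b \<longrightarrow>
      (\<exists>u. (\<gamma> has_vector_derivative u) (at t within {a..b}) \<and> norm u \<le> M)"
  shows "norm (\<gamma> b - \<gamma> a) \<le> M * (b - a)"
proof -
  define e where "e = \<gamma> b - \<gamma> a"
  have "abs_continuous_on_interval a b (\<lambda>t. e \<bullet> \<gamma> t)"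
  proof (rule abs_continuous_on_interval_lipschitz_compose[OF ac])
    show "dist (e \<bullet> \<gamma> s) (e \<bullet> \<gamma> t) \<le> norm e * dist (\<gamma> s) (\<gamma> t)" for s t
      using Cauchy_Schwarz_ineq2[of e "\<gamma> s - \<gamma> t"] by (simp add: dist_norm inner_diff_right)
  qed
  moreover have "AE t in lborel. a \<le> t \<and> t \<le> b \<longrightarrow>
      (\<exists>D\<le>norm e * M. ((\<lambda>t. e \<bullet> \<gamma> t) has_vector_derivative D) (at t within {a..b}))"
    using ae
  proof eventually_elim
    case (elim t)
    show ?case
    proof
      assume "a \<le> t \<and> t \<le> b"
      then obtain u where u: "(\<gamma> has_vector_derivative u) (at t within {a..b})" "norm u \<le> M"
        using elim by auto
      have "((\<lambda>t. e \<bullet> \<gamma> t) has_vector_derivative e \<bullet> u) (at t within {a..b})"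
        by (rule bounded_linear.has_vector_derivative[OF bounded_linear_inner_right u(1)])
      moreover have "e \<bullet> u \<le> norm e * M"
        using norm_cauchy_schwarz[of e u] mult_left_mono[OF u(2), of "norm e"] by simp
      ultimately show "\<exists>D\<le>norm e * M. ((\<lambda>t. e \<bullet> \<gamma> t) has_vector_derivative D) (at t within {a..b})"
        by blast
    qed
  qed
  ultimately have "e \<bullet> \<gamma> b - e \<bullet> \<gamma> a \<le> norm e * M * (b - a)"
    by (rule abs_continuous_on_interval_increment_le[OF \<open>a \<le> b\<close>])
  then have "norm e * norm e \<le> norm e * (M * (b - a))"
    by (simp add: e_def inner_diff_right[symmetric] power2_norm_eq_inner[symmetric] power2_eq_square mult.assoc)
  \<comment> \<open>Needed when \<open>e = 0\<close>. If \<open>M\<close> were negative and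
    \<open>a < b\<close>, the derivative condition would fail at every point, and the interval would
    be a null set.\<close>
  moreover have "0 \<le> M * (b - a)"
  proof -
    have "a = b \<or> 0 \<le> M"
    proof (rule ccontr)
      assume *: "\<not> (a = b \<or> 0 \<le> M)"
      then have "\<not> norm (u :: 'a) \<le> M" for u using norm_ge_zero[of u] by linarith
      then have "AE t in lborel. \<not> (a \<le> t \<and> t \<le> b)"
        using ae by simp
      then obtain N where N: "N \<in> null_sets lborel" "{t \<in> space lborel. \<not> \<not> (a \<le> t \<and> t \<le> b)} \<subseteq> N"
        unfolding eventually_ae_filter by blast
      then have "{a..b} \<subseteq> N" by (auto simp: subset_eq)
      then have "emeasure lborel {a..b} \<le> emeasure lborel N" using N(1) by (intro emeasure_mono) auto
      then show False using N(1) * \<open>a \<le> b\<close> by (auto simp: null_sets_def ennreal_eq_0_iff)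
    qed
    then show ?thesis using \<open>a \<le> b\<close> by auto
  qed
  ultimately show ?thesis unfolding e_def[symmetric]
    by (cases "norm e = 0") (auto simp: mult_le_cancel_left)
qed

lemma abs_continuous_on_interval_sq_dist_increment_le:
  fixes \<gamma> :: "real \<Rightarrow> 'a::real_inner"
  assumes "a \<le> b" and ac: "abs_continuous_on_interval a b \<gamma>"
    and ae: "AE t in lborel. a \<le> t \<and> t \<le> b \<longrightarrow>
      (\<exists>u. (\<gamma> has_vector_derivative u) (at t within {a..b}) \<and> (\<gamma> t - y) \<bullet> u \<le> c)"
  shows "(norm (\<gamma> b - y))\<^sup>2 - (norm (\<gamma> a - y))\<^sup>2 \<le> 2 * c * (b - a)"
proof -
  have "compact (\<gamma> ` {a..b})"
    using abs_continuous_on_interval_imp_continuous_on[OF ac] by (intro compact_continuous_image) auto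
  then have "bounded (\<gamma> ` {a..b})" by (rule compact_imp_bounded)
  then obtain R where "\<forall>x\<in>\<gamma> ` {a..b}. norm x \<le> R"
    unfolding bounded_iff by (rule exE)
  then have R: "norm (\<gamma> t) \<le> R" if "t \<in> {a..b}" for t using that by blast
  define S where "S = R + norm y"
  have S: "norm (\<gamma> t - y) \<le> S" if "t \<in> {a..b}" for t
    using R[OF that] norm_triangle_ineq4[of "\<gamma> t" y] by (simp add: S_def)
  have "abs_continuous_on_interval a b (\<lambda>t. (\<gamma> t - y) \<bullet> (\<gamma> t - y))"
  proof (rule abs_continuous_on_interval_lipschitz_compose[OF ac])
    fix s t assume st: "s \<in> {a..b}" "t \<in> {a..b}"
    \<comment> \<open>Difference of two squares, factored; the second factor is bounded by
      \<open>2 * S\<close> on the compact image.\<close>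
    have "(\<gamma> s - y) \<bullet> (\<gamma> s - y) - (\<gamma> t - y) \<bullet> (\<gamma> t - y) = (\<gamma> s - \<gamma> t) \<bullet> ((\<gamma> s - y) + (\<gamma> t - y))"
      by (simp add: inner_diff_left inner_diff_right inner_add_right inner_commute)
    then have "dist ((\<gamma> s - y) \<bullet> (\<gamma> s - y)) ((\<gamma> t - y) \<bullet> (\<gamma> t - y))
        \<le> norm (\<gamma> s - \<gamma> t) * norm ((\<gamma> s - y) + (\<gamma> t - y))"
      by (simp add: dist_real_def Cauchy_Schwarz_ineq2)
    also have "\<dots> \<le> norm (\<gamma> s - \<gamma> t) * (2 * S)"
      using S[OF st(1)] S[OF st(2)] norm_triangle_ineq[of "\<gamma> s - y" "\<gamma> t - y"]
      by (intro mult_left_mono) auto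
    finally show "dist ((\<gamma> s - y) \<bullet> (\<gamma> s - y)) ((\<gamma> t - y) \<bullet> (\<gamma> t - y)) \<le> 2 * S * dist (\<gamma> s) (\<gamma> t)"
      by (simp add: dist_norm mult_ac)
  qed
  moreover have "AE t in lborel. a \<le> t \<and> t \<le> b \<longrightarrow>
      (\<exists>D\<le>2 * c. ((\<lambda>t. (\<gamma> t - y) \<bullet> (\<gamma> t - y)) has_vector_derivative D) (at t within {a..b}))"
    using ae
  proof eventually_elim
    case (elim t)
    show ?case
    proof
      assume "a \<le> t \<and> t \<le> b"
      then obtain u where u: "(\<gamma> has_vector_derivative u) (at t within {a..b})" "(\<gamma> t - y) \<bullet> u \<le> c"
        using elim by auto
      have "((\<lambda>t. \<gamma> t - y) has_vector_derivative u) (at t within {a..b})"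
        using has_vector_derivative_diff[OF u(1) has_vector_derivative_const[of y]] by simp
      from bounded_bilinear.has_vector_derivative[OF bounded_bilinear_inner this this]
      have "((\<lambda>t. (\<gamma> t - y) \<bullet> (\<gamma> t - y)) has_vector_derivative 2 * ((\<gamma> t - y) \<bullet> u)) (at t within {a..b})"
        by (simp add: inner_commute)
      then show "\<exists>D\<le>2 * c. ((\<lambda>t. (\<gamma> t - y) \<bullet> (\<gamma> t - y)) has_vector_derivative D) (at t within {a..b})"
        using u(2) by (intro exI[of _ "2 * ((\<gamma> t - y) \<bullet> u)"]) auto
    qed
  qed
  ultimately show ?thesis
    using abs_continuous_on_interval_increment_le[OF \<open>a \<le> b\<close>] by (simp add: power2_norm_eq_inner)
qed

subsection \<open>Projected vector fields and dissipation\<close>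

text \<open>Multiplying the convergent difference quotient by its step shows that the projected
  points tend to \<open>y\<close>, and they lie in the closed set. Invariance of \<open>C\<close> is
  thus contained in the existence of the projected velocity.\<close>

lemma has_projected_vector_imp_mem:
  assumes "closed K" "K \<noteq> {}" and lim: "has_projected_vector K y w u"
  shows "y \<in> K"
proof -
  have "((\<lambda>\<delta>. y + \<delta> *\<^sub>R ((closest_point K (y + \<delta> *\<^sub>R w) - y) /\<^sub>R \<delta>)) \<longlongrightarrow> y + 0 *\<^sub>R u) (at_right (0::real))"
    using lim unfolding has_projected_vector_def by (intro tendsto_intros)
  moreover have "\<forall>\<^sub>F \<delta> in at_right (0::real).
      y + \<delta> *\<^sub>R ((closest_point K (y + \<delta> *\<^sub>R w) - y) /\<^sub>R \<delta>) = closest_point K (y + \<delta> *\<^sub>R w)"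
    unfolding eventually_at_right_field by (intro exI[of _ 1]) auto
  ultimately have "((\<lambda>\<delta>. closest_point K (y + \<delta> *\<^sub>R w)) \<longlongrightarrow> y) (at_right (0::real))"
    by (auto dest: Lim_transform_eventually)
  then show ?thesis
    by (rule Lim_in_closed_set[rotated 3])
      (use assms in \<open>auto intro!: always_eventually closest_point_in_set\<close>)
qed

text \<open>The projection is nonexpansive and fixes \<open>y\<close>, so each difference quotient
  already obeys the bound.\<close>

lemma has_projected_vector_norm_le:
  assumes "closed K" "convex K" "y \<in> K" and lim: "has_projected_vector K y w u"
  shows "norm u \<le> norm w"
proof (rule tendsto_upperbound[OF tendsto_norm[OF lim[unfolded has_projected_vector_def]]])
  have "norm ((closest_point K (y + \<delta> *\<^sub>R w) - y) /\<^sub>R \<delta>) \<le> norm w" if "\<delta> > 0" for \<delta>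
  proof -
    have "dist (closest_point K (y + \<delta> *\<^sub>R w)) (closest_point K y) \<le> dist (y + \<delta> *\<^sub>R w) y"
      using assms by (intro closest_point_lipschitz) auto
    then have "norm (closest_point K (y + \<delta> *\<^sub>R w) - y) \<le> \<delta> * norm w"
      using that assms(3) by (simp add: closest_point_self dist_norm)
    then show ?thesis using that by (simp add: divide_simps mult.commute)
  qed
  then show "\<forall>\<^sub>F \<delta> in at_right (0::real). norm ((closest_point K (y + \<delta> *\<^sub>R w) - y) /\<^sub>R \<delta>) \<le> norm w"
    unfolding eventually_at_right_field by (intro exI[of _ 1]) auto
qed simp

text \<open>Limit of the obtuse-angle characterization of the projection: \<open>w - u\<close> is a
  normal direction at \<open>y\<close>. Projecting the velocity therefore never slows the approach
  to a point of \<open>K\<close>, and the dissipation inequalities of the unprojected flow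
  survive.\<close>

lemma has_projected_vector_inner_le:
  assumes "closed K" "convex K" "y' \<in> K" and lim: "has_projected_vector K y w u"
  shows "(y - y') \<bullet> u \<le> (y - y') \<bullet> w"
proof -
  define q where "q \<delta> = (closest_point K (y + \<delta> *\<^sub>R w) - y) /\<^sub>R \<delta>" for \<delta>
  have q: "(q \<longlongrightarrow> u) (at_right 0)"
    using lim unfolding has_projected_vector_def q_def .
  have "((\<lambda>\<delta>. (w - q \<delta>) \<bullet> (y' - (y + \<delta> *\<^sub>R q \<delta>))) \<longlongrightarrow> (w - u) \<bullet> (y' - (y + 0 *\<^sub>R u))) (at_right 0)"
    by (intro tendsto_intros q)
  moreover have "(w - q \<delta>) \<bullet> (y' - (y + \<delta> *\<^sub>R q \<delta>)) \<le> 0" if "\<delta> > 0" for \<delta>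
  proof -
    have "(y + \<delta> *\<^sub>R w - closest_point K (y + \<delta> *\<^sub>R w)) \<bullet> (y' - closest_point K (y + \<delta> *\<^sub>R w)) \<le> 0"
      using assms by (intro closest_point_dot)
    moreover have "closest_point K (y + \<delta> *\<^sub>R w) = y + \<delta> *\<^sub>R q \<delta>"
      using that by (simp add: q_def)
    ultimately have "\<delta> * ((w - q \<delta>) \<bullet> (y' - (y + \<delta> *\<^sub>R q \<delta>))) \<le> 0"
      by (simp add: inner_diff_left right_diff_distrib)
    then show ?thesis using that by (simp add: mult_le_0_iff)
  qed
  then have "\<forall>\<^sub>F \<delta> in at_right 0. (w - q \<delta>) \<bullet> (y' - (y + \<delta> *\<^sub>R q \<delta>)) \<le> 0"
    unfolding eventually_at_right_field by (intro exI[of _ 1]) auto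
  ultimately have "(w - u) \<bullet> (y' - (y + 0 *\<^sub>R u)) \<le> 0"
    by (rule tendsto_upperbound) simp
  then show ?thesis by (simp add: inner_diff_left inner_diff_right inner_commute)
qed

lemma AE_ge_zero_imp_closed:
  fixes \<gamma> :: "real \<Rightarrow> 'a::metric_space"
  assumes "closed K" and cont: "\<And>T. continuous_on {0..T} \<gamma>"
    and ae: "AE t in lborel. 0 \<le> t \<longrightarrow> \<gamma> t \<in> K" and "0 \<le> t"
  shows "\<gamma> t \<in> K"
proof (rule ccontr)
  assume "\<gamma> t \<notin> K"
  then obtain e where e: "e > 0" "ball (\<gamma> t) e \<subseteq> - K"
    using \<open>closed K\<close> by (metis ComplI open_Compl open_contains_ball)
  obtain d' where d': "d' > 0" "\<And>s. 0 \<le> s \<Longrightarrow> s \<le> t + 1 \<Longrightarrow> dist s t < d' \<Longrightarrow> dist (\<gamma> s) (\<gamma> t) < e"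
    using cont[of "t + 1", unfolded continuous_on_iff, rule_format, of t e] \<open>0 \<le> t\<close> e(1) by auto
  define d where "d = min d' 1"
  have d: "d > 0" "\<And>s. 0 \<le> s \<Longrightarrow> dist s t < d \<Longrightarrow> dist (\<gamma> s) (\<gamma> t) < e"
    using d' by (auto simp: d_def dist_real_def)
  obtain N where N: "N \<in> null_sets lborel" "{s \<in> space lborel. \<not> (0 \<le> s \<longrightarrow> \<gamma> s \<in> K)} \<subseteq> N"
    using ae unfolding eventually_ae_filter by blast
  \<comment> \<open>A one-sided neighbourhood suffices for positive measure and also covers
    \<open>t = 0\<close>.\<close>
  have "{t<..<t + d} \<subseteq> N"
  proof
    fix s assume s: "s \<in> {t<..<t + d}"
    then have "dist (\<gamma> s) (\<gamma> t) < e" using d \<open>0 \<le> t\<close> by (auto simp: dist_real_def)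
    then have "\<gamma> s \<notin> K" using e(2) by (auto simp: dist_commute)
    then show "s \<in> N" using N(2) s \<open>0 \<le> t\<close> by auto
  qed
  then have "emeasure lborel {t<..<t + d} \<le> emeasure lborel N" using N(1) by (intro emeasure_mono) auto
  then show False using N(1) d by (auto simp: null_sets_def ennreal_eq_0_iff)
qed

text \<open>An argument of Barbalat type. The dissipation is stated through constant lower bounds on
  windows, so no integral of \<open>w\<close> is required. If \<open>w s \<ge> e\<close> at a late
  time, uniform continuity keeps \<open>w\<close> above \<open>e / 2\<close> for a fixed length
  \<open>d\<close>, and \<open>V\<close> would fall below its infimum.\<close>

lemma dissipation_tendsto_0:
  fixes V w :: "real \<Rightarrow> real"
  assumes V: "\<And>t. 0 \<le> t \<Longrightarrow> 0 \<le> V t" and w: "\<And>t. 0 \<le> t \<Longrightarrow> 0 \<le> w t"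
    and diss: "\<And>s t c. 0 \<le> s \<Longrightarrow> s \<le> t \<Longrightarrow> (\<And>r. s \<le> r \<Longrightarrow> r \<le> t \<Longrightarrow> c \<le> w r) \<Longrightarrow> V t - V s \<le> - c * (t - s)"
    and uc: "uniformly_continuous_on {0..} w"
  shows "(w \<longlongrightarrow> 0) at_top"
proof (rule tendstoI)
  fix e :: real assume "e > 0"
  then have "e / 2 > 0" by simp
  then obtain d' where "d' > 0" and d': "\<And>s t. 0 \<le> s \<Longrightarrow> 0 \<le> t \<Longrightarrow> dist s t < d' \<Longrightarrow> dist (w s) (w t) < e / 2"
    using uc[unfolded uniformly_continuous_on_def, rule_format, of "e / 2"] by auto
  define d where "d = d' / 2"
  have "d > 0" "d < d'" using \<open>d' > 0\<close> by (auto simp: d_def)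
  have bdd: "bdd_below (V ` {0..})" using V by (auto intro!: bdd_belowI[of _ 0])
  \<comment> \<open>From \<open>t0\<close> on, the remaining drop of \<open>V\<close> is less than
    the drop \<open>e / 2 * d\<close> forced by one such window.\<close>
  then obtain t0 where t0: "0 \<le> t0" "V t0 < Inf (V ` {0..}) + e / 2 * d"
    using cInf_lessD[of "V ` {0..}" "Inf (V ` {0..}) + e / 2 * d"] \<open>e > 0\<close> \<open>d > 0\<close> by auto
  have "dist (w s) 0 < e" if s: "s \<ge> t0" for s
  proof -
    have s0: "0 \<le> s" using s t0 by simp
    have "V s - V t0 \<le> - 0 * (s - t0)" using t0 s w by (intro diss) auto
    moreover have "Inf (V ` {0..}) \<le> V (s + d)" using bdd s0 \<open>d > 0\<close> by (intro cInf_lower) auto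
    ultimately have "V s - V (s + d) < e / 2 * d" using t0 by simp
    moreover have "V (s + d) - V s \<le> - (w s - e / 2) * ((s + d) - s)"
    proof (rule diss)
      fix r assume "s \<le> r" "r \<le> s + d"
      then have "dist (w s) (w r) < e / 2" using s0 \<open>d < d'\<close> by (intro d') (auto simp: dist_real_def)
      then have "\<bar>w s - w r\<bar> < e / 2" by (simp only: dist_real_def)
      then show "w s - e / 2 \<le> w r" by linarith
    qed (use s0 \<open>d > 0\<close> in auto)
    ultimately have "(w s - e / 2) * d < e / 2 * d" by (simp add: algebra_simps)
    then have "w s < e" using \<open>d > 0\<close> by (simp add: mult_less_cancel_right)
    then show ?thesis using w[OF s0] by simp
  qed
  then show "\<forall>\<^sub>F t in at_top. dist (w t) 0 < e" unfolding eventually_at_top_linorder by blast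
qed

lemma inner_sgn_self: "x \<bullet> sgn x = norm x" for x :: "'a::real_inner"
  by (cases "x = 0") (simp_all add: sgn_div_norm power2_norm_eq_inner[symmetric] power2_eq_square)

subsection \<open>Projected saddle flows\<close>

text \<open>The gradients enter only through their convexity inequalities. \<open>grad_p\<close>
  holds on the whole space, because \<Phi> is convex there; \<open>grad_z\<close> is demanded on
  \<open>C\<close> only, where concavity in the dual variables is given. Strong concavity is
  recorded as quadratic decay away from the maximizer \<open>zs\<close>.\<close>

locale projected_saddle_flow =
  fixes C :: "'a::euclidean_space set" and B :: "'a \<Rightarrow> 'a"
    and \<Phi> :: "'a \<Rightarrow> 'b::euclidean_space \<Rightarrow> real"
    and GP :: "'a \<Rightarrow> 'a \<Rightarrow> 'b \<Rightarrow> 'a" and GZ :: "'a \<Rightarrow> 'b \<Rightarrow> 'b"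
    and L :: "'a \<Rightarrow> 'a \<Rightarrow> 'b \<Rightarrow> real"
    and ps ms :: 'a and zs :: 'b and \<kappa> :: real
    and p m :: "real \<Rightarrow> 'a" and z :: "real \<Rightarrow> 'b"
  assumes closed_C: "closed C" and convex_C: "convex C"
    and linear_B: "linear B" and sym_B: "\<And>p q. p \<bullet> B q = B p \<bullet> q" and psd_B: "\<And>p. 0 \<le> p \<bullet> B p"
    and L_eq: "\<And>p m z. L p m z = \<Phi> p z + m \<bullet> B p + 1 / 2 * (p \<bullet> B p)"
    and cont_\<Phi>: "continuous_on UNIV (\<lambda>(p, z). \<Phi> p z)"
    and convex_\<Phi>: "\<And>z. convex_on UNIV (\<lambda>p. \<Phi> p z)"
    and grad_p: "\<And>p p' m z. GP p m z \<bullet> (p' - p) \<le> L p' m z - L p m z"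
    and grad_z: "\<And>p z z'. p \<in> C \<Longrightarrow> \<Phi> p z' - \<Phi> p z \<le> GZ p z \<bullet> (z' - z)"
    and ps: "ps \<in> interior C"
    and saddle_max: "\<And>m z. L ps m z \<le> L ps ms zs"
    and saddle_min: "\<And>p. p \<in> C \<Longrightarrow> L ps ms zs \<le> L p ms zs"
    and \<kappa>: "0 < \<kappa>" and strong_max: "\<And>z. \<kappa> * (norm (z - zs))\<^sup>2 \<le> \<Phi> ps zs - \<Phi> ps z"
    and ac: "\<And>T. 0 \<le> T \<Longrightarrow> abs_continuous_on_interval 0 T (\<lambda>t. (p t, m t, z t))"
    and flow: "AE t in lborel. 0 \<le> t \<longrightarrow>
      (\<exists>u. has_projected_vector C (p t) (- GP (p t) (m t) (z t)) u \<and>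
           (p has_vector_derivative u) (at t within {0..})) \<and>
      (m has_vector_derivative B (p t)) (at t within {0..}) \<and>
      (z has_vector_derivative GZ (p t) (z t)) (at t within {0..})"
begin

interpretation B: bounded_linear B
  using linear_B by (rule linear_conv_bounded_linear[THEN iffD1])

section \<open>Consequences of the saddle inequalities\<close>

lemma ps_in_C: "ps \<in> C"
  using ps interior_subset by auto

lemma continuous_\<Phi>: "continuous_on S f \<Longrightarrow> continuous_on S d \<Longrightarrow> continuous_on S (\<lambda>x. \<Phi> (f x) (d x))"
  using continuous_on_compose2[OF cont_\<Phi>, of S "\<lambda>x. (f x, d x)"] by (simp add: continuous_on_Pair)

lemma continuous_L:
  "continuous_on S f \<Longrightarrow> continuous_on S e \<Longrightarrow> continuous_on S d \<Longrightarrow> continuous_on S (\<lambda>x. L (f x) (e x) (d x))"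
  unfolding L_eq by (intro continuous_intros continuous_\<Phi> B.continuous_on)

lemma tendsto_\<Phi>: "(f \<longlongrightarrow> a) net \<Longrightarrow> (d \<longlongrightarrow> b) net \<Longrightarrow> ((\<lambda>x. \<Phi> (f x) (d x)) \<longlongrightarrow> \<Phi> a b) net"
  using continuous_on_tendsto_compose[OF cont_\<Phi>, of "\<lambda>x. (f x, d x)" "(a, b)" net] by (simp add: tendsto_Pair)

lemma tendsto_L:
  "(f \<longlongrightarrow> a) net \<Longrightarrow> (e \<longlongrightarrow> b) net \<Longrightarrow> (d \<longlongrightarrow> c) net \<Longrightarrow> ((\<lambda>x. L (f x) (e x) (d x)) \<longlongrightarrow> L a b c) net"
  unfolding L_eq by (intro tendsto_intros tendsto_\<Phi> B.tendsto)

text \<open>\<open>L\<close> is affine in the multiplier with slope \<open>B ps\<close>; being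
  bounded above, it must have slope zero. Moving the multiplier in the direction of the slope itself
  shows this.\<close>

lemma B_ps: "B ps = 0"
proof -
  have "L ps (ms + B ps) zs \<le> L ps ms zs" by (rule saddle_max)
  then have "B ps \<bullet> B ps \<le> 0" by (simp add: L_eq inner_add_left)
  then show ?thesis by (metis inner_eq_zero_iff inner_ge_zero order_antisym)
qed

lemma quad_shift: "(ps + q) \<bullet> B (ps + q) = q \<bullet> B q"
proof -
  have "ps \<bullet> B q = 0" using sym_B[of ps q] B_ps by simp
  then show ?thesis by (simp add: B.add B_ps inner_add_left)
qed

text \<open>With \<open>G\<close> denoting \<open>L\<close> without its quadratic term, minimality
  at \<open>ps + s *\<^sub>R r\<close> and convexity of \<open>G\<close> leave an error of order
  \<open>s\<close> after division by \<open>s\<close>, hence \<open>G ps \<le> G q\<close>. The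
  whole quadratic term of \<open>q\<close> remains as a surplus. Small steps stay in
  \<open>C\<close> since \<open>ps\<close> is interior, while \<open>q\<close> itself is arbitrary;
  this global minimality later serves problem (D).\<close>

lemma quad_growth: "1 / 2 * (q \<bullet> B q) \<le> L q ms zs - L ps ms zs"
proof -
  define G where "G p = \<Phi> p zs + ms \<bullet> B p" for p
  define r where "r = q - ps"
  have q: "q = ps + r" by (simp add: r_def)
  have LG: "L p ms zs = G p + 1 / 2 * (p \<bullet> B p)" for p by (simp add: L_eq G_def)
  have Lps: "L ps ms zs = G ps" by (simp add: LG B_ps)
  have "open (interior C)" by simp
  then obtain e where e: "e > 0" "ball ps e \<subseteq> C"
    using ps interior_subset unfolding open_contains_ball by blast
  \<comment> \<open>Keeps the displacement within \<open>e / 2\<close> of \<open>ps\<close> and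
    \<open>s\<close> in the unit interval.\<close>
  define s0 where "s0 = min 1 (e / (2 * (norm r + 1)))"
  have s0: "s0 > 0" "s0 \<le> 1" using e by (auto simp: s0_def intro!: divide_pos_pos add_nonneg_pos)
  have *: "0 \<le> G q - G ps + s * (1 / 2 * (r \<bullet> B r))" if s: "0 < s" "s \<le> s0" for s
  proof -
    have "s * (norm r + 1) \<le> e / 2"
    proof -
      have "s \<le> e / (2 * (norm r + 1))" using s by (simp add: s0_def)
      then have "s * (norm r + 1) \<le> e / (2 * (norm r + 1)) * (norm r + 1)"
        by (intro mult_right_mono) auto
      also have "\<dots> = e / 2" by (simp add: field_simps add_nonneg_eq_0_iff)
      finally show ?thesis .
    qed
    then have "norm (s *\<^sub>R r) < e" using s e by (simp add: distrib_left)
    then have "ps + s *\<^sub>R r \<in> C" using e by (auto simp: dist_norm)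
    then have "L ps ms zs \<le> L (ps + s *\<^sub>R r) ms zs" by (rule saddle_min)
    then have 1: "G ps \<le> G (ps + s *\<^sub>R r) + s * s * (1 / 2 * (r \<bullet> B r))"
      unfolding Lps unfolding LG quad_shift by (simp add: B.scaleR)
    have "\<Phi> ((1 - s) *\<^sub>R ps + s *\<^sub>R q) zs \<le> (1 - s) * \<Phi> ps zs + s * \<Phi> q zs"
      using s s0 by (intro convex_onD[OF convex_\<Phi>]) auto
    moreover have eq: "(1 - s) *\<^sub>R ps + s *\<^sub>R q = ps + s *\<^sub>R r"
      by (simp add: r_def algebra_simps)
    ultimately have "\<Phi> (ps + s *\<^sub>R r) zs \<le> (1 - s) * \<Phi> ps zs + s * \<Phi> q zs" by simp
    then have "G (ps + s *\<^sub>R r) \<le> (1 - s) * G ps + s * G q"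
      unfolding G_def q by (simp add: B.add B.scaleR B_ps algebra_simps)
    with 1 have "0 \<le> s * (G q - G ps + s * (1 / 2 * (r \<bullet> B r)))"
      by (simp add: algebra_simps)
    then show ?thesis using s by (simp add: zero_le_mult_iff)
  qed
  have lim: "((\<lambda>s. G q - G ps + s * (1 / 2 * (r \<bullet> B r))) \<longlongrightarrow> G q - G ps + 0 * (1 / 2 * (r \<bullet> B r))) (at_right 0)"
    by (intro tendsto_intros)
  have "0 \<le> G q - G ps + 0 * (1 / 2 * (r \<bullet> B r))"
    by (rule tendsto_lowerbound[OF lim])
      (use * s0 in \<open>auto simp: eventually_at_right_field intro!: exI[of _ s0]\<close>)
  then show ?thesis unfolding LG by (simp add: B_ps)
qed

definition W where "W q n y = L q ms zs - L ps n y"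

text \<open>\<open>W\<close> is a primal gap plus a dual gap. The primal gap gives the quadratic
  form; in the dual gap the multipliers cancel because \<open>B ps = 0\<close>, which leaves the
  decay of \<Phi> around \<open>zs\<close>.\<close>

lemma W_lower: "1 / 2 * (q \<bullet> B q) + \<kappa> * (norm (y - zs))\<^sup>2 \<le> W q n y"
  using quad_growth[of q] strong_max[of y] by (simp add: W_def L_eq B_ps)

lemma W_ge_gap: "L q ms zs - L ps ms zs \<le> W q n y"
  using saddle_max[of n y] by (simp add: W_def)

lemma W_nonneg: "0 \<le> W q n y"
proof -
  have "0 \<le> \<kappa> * (norm (y - zs))\<^sup>2" using \<kappa> by simp
  then show ?thesis using W_lower[of q y n] psd_B[of q] by linarith
qed

section \<open>The trajectory and its almost-everywhere differential inequalities\<close>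

definition \<Gamma> where "\<Gamma> t = (p t, m t, z t)"

lemma ac_\<Gamma>: "0 \<le> s \<Longrightarrow> s \<le> t \<Longrightarrow> abs_continuous_on_interval s t \<Gamma>"
  unfolding \<Gamma>_def using ac[of t] by (auto intro: abs_continuous_on_interval_subset)

lemma ac_p: "0 \<le> s \<Longrightarrow> s \<le> t \<Longrightarrow> abs_continuous_on_interval s t p"
  by (rule abs_continuous_on_interval_lipschitz_compose[OF ac_\<Gamma>, where K = 1])
    (auto simp: \<Gamma>_def dist_fst_le[of "(_, _)" "(_, _)", simplified])

lemma ac_m: "0 \<le> s \<Longrightarrow> s \<le> t \<Longrightarrow> abs_continuous_on_interval s t m"
  by (rule abs_continuous_on_interval_lipschitz_compose[OF ac_\<Gamma>, where K = 1])
    (auto simp: \<Gamma>_def intro: order_trans[OF dist_fst_le[of "(m _, z _)" "(m _, z _)", simplified] dist_snd_le[of "(p _, m _, z _)" "(p _, m _, z _)", simplified]])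

lemma ac_z: "0 \<le> s \<Longrightarrow> s \<le> t \<Longrightarrow> abs_continuous_on_interval s t z"
  by (rule abs_continuous_on_interval_lipschitz_compose[OF ac_\<Gamma>, where K = 1])
    (auto simp: \<Gamma>_def intro: order_trans[OF dist_snd_le[of "(m _, z _)" "(m _, z _)", simplified] dist_snd_le[of "(p _, m _, z _)" "(p _, m _, z _)", simplified]])

lemma p_in_C: "p t \<in> C" if "0 \<le> t"
proof (rule AE_ge_zero_imp_closed[OF closed_C _ _ that])
  show "continuous_on {0..T} p" for T
    using abs_continuous_on_interval_imp_continuous_on[OF ac_p[of 0 T]] by (cases "0 \<le> T") auto
  show "AE t in lborel. 0 \<le> t \<longrightarrow> p t \<in> C"
    using flow by (rule AE_mp) (use ps_in_C closed_C in \<open>auto intro: has_projected_vector_imp_mem\<close>)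
qed

text \<open>From here on the projection is gone: the primal velocity is kept only through its norm
  bound and the inequality tested against points of \<open>C\<close>.\<close>

lemma flow_within:
  assumes "0 \<le> s"
  shows "AE r in lborel. s \<le> r \<and> r \<le> t \<longrightarrow>
    (\<exists>u. (p has_vector_derivative u) (at r within {s..t}) \<and>
      norm u \<le> norm (GP (p r) (m r) (z r)) \<and>
      (\<forall>q\<in>C. (p r - q) \<bullet> u \<le> L q (m r) (z r) - L (p r) (m r) (z r))) \<and>
    (m has_vector_derivative B (p r)) (at r within {s..t}) \<and>
    (z has_vector_derivative GZ (p r) (z r)) (at r within {s..t})"
  using flow
proof eventually_elim
  case (elim r)
  show ?case
  proof
    assume r: "s \<le> r \<and> r \<le> t"
    have sub: "{s..t} \<subseteq> {0..}" using assms by auto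
    have r0: "0 \<le> r" using r assms by simp
    obtain u where u: "has_projected_vector C (p r) (- GP (p r) (m r) (z r)) u"
      "(p has_vector_derivative u) (at r within {0..})"
      and mz: "(m has_vector_derivative B (p r)) (at r within {0..})"
      "(z has_vector_derivative GZ (p r) (z r)) (at r within {0..})"
      using elim r0 by blast
    have "(p r - q) \<bullet> u \<le> L q (m r) (z r) - L (p r) (m r) (z r)" if "q \<in> C" for q
    proof -
      have "(p r - q) \<bullet> u \<le> (p r - q) \<bullet> - GP (p r) (m r) (z r)"
        by (rule has_projected_vector_inner_le[OF closed_C convex_C that u(1)])
      also have "\<dots> = GP (p r) (m r) (z r) \<bullet> (q - p r)"
        by (simp add: inner_diff_left inner_diff_right inner_commute)
      also have "\<dots> \<le> L q (m r) (z r) - L (p r) (m r) (z r)" by (rule grad_p)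
      finally show ?thesis .
    qed
    moreover have "norm u \<le> norm (GP (p r) (m r) (z r))"
      using has_projected_vector_norm_le[OF closed_C convex_C p_in_C[OF r0] u(1)] by simp
    ultimately show "(\<exists>u. (p has_vector_derivative u) (at r within {s..t}) \<and>
      norm u \<le> norm (GP (p r) (m r) (z r)) \<and>
      (\<forall>q\<in>C. (p r - q) \<bullet> u \<le> L q (m r) (z r) - L (p r) (m r) (z r))) \<and>
    (m has_vector_derivative B (p r)) (at r within {s..t}) \<and>
    (z has_vector_derivative GZ (p r) (z r)) (at r within {s..t})"
      using u(2) mz sub by (blast intro: has_vector_derivative_within_subset)
  qed
qed

section \<open>Integrated estimates on a time window\<close>

lemma p_increment:
  assumes st: "0 \<le> s" "s \<le> t" and q: "q \<in> C"
    and c: "\<And>r. s \<le> r \<Longrightarrow> r \<le> t \<Longrightarrow> L q (m r) (z r) - L (p r) (m r) (z r) \<le> c"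
  shows "(norm (p t - q))\<^sup>2 - (norm (p s - q))\<^sup>2 \<le> 2 * c * (t - s)"
proof (rule abs_continuous_on_interval_sq_dist_increment_le[OF st(2) ac_p[OF st]])
  show "AE r in lborel. s \<le> r \<and> r \<le> t \<longrightarrow>
      (\<exists>u. (p has_vector_derivative u) (at r within {s..t}) \<and> (p r - q) \<bullet> u \<le> c)"
    using flow_within[OF st(1), of t]
  \<comment> \<open>The dual variables have their current values on both sides of the gap, so
    \<open>q\<close> need not belong to any saddle point.\<close>
  proof eventually_elim
    case (elim r)
    then show ?case using c[of r] q by (meson order_trans)
  qed
qed

lemma z_increment:
  assumes st: "0 \<le> s" "s \<le> t"
    and c: "\<And>r. s \<le> r \<Longrightarrow> r \<le> t \<Longrightarrow> \<Phi> (p r) (z r) - \<Phi> (p r) y \<le> c"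
  shows "(norm (z t - y))\<^sup>2 - (norm (z s - y))\<^sup>2 \<le> 2 * c * (t - s)"
proof (rule abs_continuous_on_interval_sq_dist_increment_le[OF st(2) ac_z[OF st]])
  show "AE r in lborel. s \<le> r \<and> r \<le> t \<longrightarrow>
      (\<exists>u. (z has_vector_derivative u) (at r within {s..t}) \<and> (z r - y) \<bullet> u \<le> c)"
    using flow_within[OF st(1), of t]
  proof eventually_elim
    case (elim r)
    show ?case
    proof
      assume r: "s \<le> r \<and> r \<le> t"
      have "(z r - y) \<bullet> GZ (p r) (z r) \<le> \<Phi> (p r) (z r) - \<Phi> (p r) y"
        using grad_z[OF p_in_C[of r], of y "z r"] r st(1)
        by (simp add: inner_diff_left inner_diff_right inner_commute)
      also have "\<dots> \<le> c" using c[of r] r by simp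
      finally show "\<exists>u. (z has_vector_derivative u) (at r within {s..t}) \<and> (z r - y) \<bullet> u \<le> c"
        using elim r by blast
    qed
  qed
qed

lemma m_increment:
  assumes st: "0 \<le> s" "s \<le> t"
    and c: "\<And>r. s \<le> r \<Longrightarrow> r \<le> t \<Longrightarrow> norm (B (p r)) \<le> c"
  shows "norm (m t - m s) \<le> c * (t - s)"
proof (rule abs_continuous_on_interval_norm_increment_le[OF st(2) ac_m[OF st]])
  show "AE r in lborel. s \<le> r \<and> r \<le> t \<longrightarrow>
      (\<exists>u. (m has_vector_derivative u) (at r within {s..t}) \<and> norm u \<le> c)"
    using flow_within[OF st(1), of t] by eventually_elim (use c in blast)
qed

text \<open>The primal inequality and the two dual ones share the current value
  \<open>L (p r) (m r) (z r)\<close>, which cancels; the multiplier part is exact because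
  \<open>L\<close> is affine there. At a saddle point the remaining difference is nonpositive. This
  serves twice, for the given saddle point and for the limit.\<close>

lemma \<Gamma>_increment:
  assumes st: "0 \<le> s" "s \<le> t" and q: "q \<in> C"
    and c: "\<And>r. s \<le> r \<Longrightarrow> r \<le> t \<Longrightarrow> L q (m r) (z r) - L (p r) n y \<le> c"
  shows "(norm (\<Gamma> t - (q, n, y)))\<^sup>2 - (norm (\<Gamma> s - (q, n, y)))\<^sup>2 \<le> 2 * c * (t - s)"
proof (rule abs_continuous_on_interval_sq_dist_increment_le[OF st(2) ac_\<Gamma>[OF st]])
  show "AE r in lborel. s \<le> r \<and> r \<le> t \<longrightarrow>
      (\<exists>u. (\<Gamma> has_vector_derivative u) (at r within {s..t}) \<and> (\<Gamma> r - (q, n, y)) \<bullet> u \<le> c)"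
    using flow_within[OF st(1), of t]
  proof eventually_elim
    case (elim r)
    show ?case
    proof
      assume r: "s \<le> r \<and> r \<le> t"
      then obtain u where u: "(p has_vector_derivative u) (at r within {s..t})"
        "(p r - q) \<bullet> u \<le> L q (m r) (z r) - L (p r) (m r) (z r)"
        "(m has_vector_derivative B (p r)) (at r within {s..t})"
        "(z has_vector_derivative GZ (p r) (z r)) (at r within {s..t})"
        using elim q by blast
      have "(\<Gamma> has_vector_derivative (u, B (p r), GZ (p r) (z r))) (at r within {s..t})"
        unfolding \<Gamma>_def by (intro has_vector_derivative_Pair u)
      moreover have "(\<Gamma> r - (q, n, y)) \<bullet> (u, B (p r), GZ (p r) (z r))
          = (p r - q) \<bullet> u + (m r - n) \<bullet> B (p r) + (z r - y) \<bullet> GZ (p r) (z r)"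
        by (simp add: \<Gamma>_def)
      moreover have "(z r - y) \<bullet> GZ (p r) (z r) \<le> \<Phi> (p r) (z r) - \<Phi> (p r) y"
        using grad_z[OF p_in_C[of r], of y "z r"] r st(1)
        by (simp add: inner_diff_left inner_diff_right inner_commute)
      moreover have "(m r - n) \<bullet> B (p r) + (\<Phi> (p r) (z r) - \<Phi> (p r) y) = L (p r) (m r) (z r) - L (p r) n y"
        by (simp add: L_eq inner_diff_left)
      moreover have "L q (m r) (z r) - L (p r) n y \<le> c" using c r by simp
      ultimately show "\<exists>u. (\<Gamma> has_vector_derivative u) (at r within {s..t}) \<and> (\<Gamma> r - (q, n, y)) \<bullet> u \<le> c"
        using u(2) by (intro exI[of _ "(u, B (p r), GZ (p r) (z r))"]) linarith
    qed
  qed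
qed

lemma dissipation:
  assumes "0 \<le> s" "s \<le> t" and c: "\<And>r. s \<le> r \<Longrightarrow> r \<le> t \<Longrightarrow> c \<le> W (p r) (m r) (z r)"
  shows "(norm (\<Gamma> t - (ps, ms, zs)))\<^sup>2 / 2 - (norm (\<Gamma> s - (ps, ms, zs)))\<^sup>2 / 2 \<le> - c * (t - s)"
proof -
  have "(norm (\<Gamma> t - (ps, ms, zs)))\<^sup>2 - (norm (\<Gamma> s - (ps, ms, zs)))\<^sup>2 \<le> 2 * (- c) * (t - s)"
  proof (rule \<Gamma>_increment[OF assms(1,2) ps_in_C])
    fix r assume "s \<le> r" "r \<le> t"
    then show "L ps (m r) (z r) - L (p r) ms zs \<le> - c" using c[of r] by (simp add: W_def)
  qed
  then show ?thesis by simp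
qed

lemma bounded_\<Gamma>: "\<exists>R. \<forall>t\<ge>0. norm (\<Gamma> t) \<le> R"
proof (intro exI allI impI)
  fix t :: real assume "0 \<le> t"
  then have "(norm (\<Gamma> t - (ps, ms, zs)))\<^sup>2 / 2 - (norm (\<Gamma> 0 - (ps, ms, zs)))\<^sup>2 / 2 \<le> - 0 * (t - 0)"
    by (intro dissipation W_nonneg) auto
  then have "norm (\<Gamma> t - (ps, ms, zs)) \<le> norm (\<Gamma> 0 - (ps, ms, zs))"
    by (intro power2_le_imp_le[OF _ norm_ge_zero]) linarith
  then show "norm (\<Gamma> t) \<le> norm (\<Gamma> 0 - (ps, ms, zs)) + norm (ps, ms, zs)"
    using norm_triangle_sub[of "\<Gamma> t" "(ps, ms, zs)"] by linarith
qed

lemma norm_le_\<Gamma>: "norm (p t) \<le> norm (\<Gamma> t)" "norm (m t) \<le> norm (\<Gamma> t)" "norm (z t) \<le> norm (\<Gamma> t)"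
  using norm_fst_le[of "p t" "(m t, z t)"] norm_snd_le[of "(m t, z t)" "p t"]
    norm_fst_le[of "m t" "z t"] norm_snd_le[of "z t" "m t"]
  by (auto simp: \<Gamma>_def)

text \<open>The gradients are not assumed continuous here: a convex function bounded by \<open>M\<close> on a unit
  neighbourhood of a point has gradient of norm at most \<open>2 * M\<close> there.\<close>

lemma lipschitz_\<Gamma>: "\<exists>M\<ge>0. \<forall>s t. 0 \<le> s \<longrightarrow> s \<le> t \<longrightarrow> norm (\<Gamma> t - \<Gamma> s) \<le> M * (t - s)"
proof -
  obtain R where R: "\<And>t. 0 \<le> t \<Longrightarrow> norm (\<Gamma> t) \<le> R" using bounded_\<Gamma> by blast
  \<comment> \<open>The ball for the primal slot has radius \<open>R + 1\<close> to contain unit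
    steps away from the trajectory; for \<Phi> below, the slot of \<open>z\<close> is enlarged
    instead.\<close>
  have "compact ((\<lambda>(q, n, y). L q n y) ` (cball 0 (R + 1) \<times> cball 0 R \<times> cball 0 R))"
    by (rule compact_continuous_image)
      (auto simp: case_prod_unfold intro!: continuous_L continuous_intros compact_Times)
  then obtain M1 where "\<forall>x\<in>(\<lambda>(q, n, y). L q n y) ` (cball 0 (R + 1) \<times> cball 0 R \<times> cball 0 R). norm x \<le> M1"
    by (auto dest!: compact_imp_bounded simp: bounded_iff simp del: image_iff)
  then have M1: "\<bar>L q n y\<bar> \<le> M1" if "norm q \<le> R + 1" "norm n \<le> R" "norm y \<le> R" for q n y
    using that by auto
  have "compact ((\<lambda>(q, y). \<Phi> q y) ` (cball 0 R \<times> cball 0 (R + 1)))"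
    by (rule compact_continuous_image) (auto intro!: continuous_on_subset[OF cont_\<Phi>] compact_Times)
  then obtain M2 where "\<forall>x\<in>(\<lambda>(q, y). \<Phi> q y) ` (cball 0 R \<times> cball 0 (R + 1)). norm x \<le> M2"
    by (auto dest!: compact_imp_bounded simp: bounded_iff simp del: image_iff)
  then have M2: "\<bar>\<Phi> q y\<bar> \<le> M2" if "norm q \<le> R" "norm y \<le> R + 1" for q y
    using that by auto
  obtain K where K: "\<And>q. norm (B q) \<le> norm q * K" using B.bounded by blast
  define M where "M = 2 * M1 + (\<bar>R * K\<bar> + 2 * M2)"
  have GP: "norm (GP (p t) (m t) (z t)) \<le> 2 * M1" if "0 \<le> t" for t
  proof -
    have b: "norm (p t) \<le> R" "norm (m t) \<le> R" "norm (z t) \<le> R"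
      using norm_le_\<Gamma>[of t] R[OF that] by auto
    define e where "e = sgn (GP (p t) (m t) (z t))"
    have "norm e \<le> 1" by (simp add: e_def norm_sgn)
    have "GP (p t) (m t) (z t) \<bullet> ((p t + e) - p t) \<le> L (p t + e) (m t) (z t) - L (p t) (m t) (z t)"
      by (rule grad_p)
    moreover have "GP (p t) (m t) (z t) \<bullet> e = norm (GP (p t) (m t) (z t))"
      unfolding e_def by (rule inner_sgn_self)
    moreover have "\<bar>L (p t + e) (m t) (z t)\<bar> \<le> M1" "\<bar>L (p t) (m t) (z t)\<bar> \<le> M1"
      using b \<open>norm e \<le> 1\<close> norm_triangle_ineq[of "p t" e] by (auto intro!: M1)
    ultimately show ?thesis by simp
  qed
  have GZ: "norm (GZ (p t) (z t)) \<le> 2 * M2" if "0 \<le> t" for t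
  proof -
    have b: "norm (p t) \<le> R" "norm (m t) \<le> R" "norm (z t) \<le> R"
      using norm_le_\<Gamma>[of t] R[OF that] by auto
    define e where "e = sgn (GZ (p t) (z t))"
    have "norm e \<le> 1" by (simp add: e_def norm_sgn)
    \<comment> \<open>For a concave function the unit step goes against the gradient, so that the
      linear bound becomes minus its norm.\<close>
    have "\<Phi> (p t) (z t - e) - \<Phi> (p t) (z t) \<le> GZ (p t) (z t) \<bullet> ((z t - e) - z t)"
      using p_in_C[OF that] by (rule grad_z)
    moreover have "GZ (p t) (z t) \<bullet> e = norm (GZ (p t) (z t))"
      unfolding e_def by (rule inner_sgn_self)
    moreover have "\<bar>\<Phi> (p t) (z t - e)\<bar> \<le> M2" "\<bar>\<Phi> (p t) (z t)\<bar> \<le> M2"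
      using b \<open>norm e \<le> 1\<close> norm_triangle_ineq4[of "z t" e] by (auto intro!: M2)
    ultimately show ?thesis by simp
  qed
  have "norm (\<Gamma> t - \<Gamma> s) \<le> M * (t - s)" if st: "0 \<le> s" "s \<le> t" for s t
  proof (rule abs_continuous_on_interval_norm_increment_le[OF st(2) ac_\<Gamma>[OF st]])
    show "AE r in lborel. s \<le> r \<and> r \<le> t \<longrightarrow>
        (\<exists>u. (\<Gamma> has_vector_derivative u) (at r within {s..t}) \<and> norm u \<le> M)"
      using flow_within[OF st(1), of t]
    proof eventually_elim
      case (elim r)
      show ?case
      proof
        assume r: "s \<le> r \<and> r \<le> t"
        then have r0: "0 \<le> r" using st by simp
        obtain u where u: "(p has_vector_derivative u) (at r within {s..t})"
          "norm u \<le> norm (GP (p r) (m r) (z r))"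
          "(m has_vector_derivative B (p r)) (at r within {s..t})"
          "(z has_vector_derivative GZ (p r) (z r)) (at r within {s..t})"
          using elim r by blast
        have "(\<Gamma> has_vector_derivative (u, B (p r), GZ (p r) (z r))) (at r within {s..t})"
          unfolding \<Gamma>_def by (intro has_vector_derivative_Pair u)
        moreover have "norm (u, B (p r), GZ (p r) (z r)) \<le> M"
        proof -
          have "norm (B (p r)) \<le> \<bar>R * K\<bar>"
          proof -
            have "norm (B (p r)) \<le> norm (p r) * \<bar>K\<bar>"
              using K[of "p r"] mult_left_mono[OF abs_ge_self[of K] norm_ge_zero[of "p r"]] by linarith
            also have "\<dots> \<le> R * \<bar>K\<bar>"
              using norm_le_\<Gamma>(1)[of r] R[OF r0] by (intro mult_right_mono) auto
            also have "\<dots> \<le> \<bar>R * K\<bar>" by (simp add: abs_mult mult_right_mono)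
            finally show ?thesis .
          qed
          then show ?thesis
            using norm_Pair_le[of u "(B (p r), GZ (p r) (z r))"] norm_Pair_le[of "B (p r)" "GZ (p r) (z r)"]
              GP[OF r0] GZ[OF r0] u(2) by (simp add: M_def)
        qed
        ultimately show "\<exists>u. (\<Gamma> has_vector_derivative u) (at r within {s..t}) \<and> norm u \<le> M" by blast
      qed
    qed
  qed
  moreover have "0 \<le> M"
    using GP[of 0] GZ[of 0] norm_ge_zero order_trans unfolding M_def
    by (metis abs_ge_zero add_nonneg_nonneg order_refl)
  ultimately show ?thesis by blast
qed

section \<open>Asymptotics of the trajectory\<close>

lemma uniformly_continuous_on_\<Gamma>: "uniformly_continuous_on {0..} \<Gamma>"
proof -
  obtain M where M: "0 \<le> M" "\<And>s t. 0 \<le> s \<Longrightarrow> s \<le> t \<Longrightarrow> norm (\<Gamma> t - \<Gamma> s) \<le> M * (t - s)"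
    using lipschitz_\<Gamma> by blast
  have *: "dist (\<Gamma> t) (\<Gamma> s) \<le> M * dist t s" if "0 \<le> s" "0 \<le> t" for s t
  proof (cases "s \<le> t")
    case True
    then show ?thesis using M(2)[of s t] that unfolding dist_norm by auto
  next
    case False
    then show ?thesis using M(2)[of t s] that unfolding dist_norm norm_minus_commute[of "\<Gamma> t"] by auto
  qed
  have "M-lipschitz_on {0..} \<Gamma>" using * M(1) by (auto intro!: lipschitz_onI)
  then show ?thesis by (rule lipschitz_on_uniformly_continuous)
qed

lemma W_tendsto_0: "((\<lambda>t. W (p t) (m t) (z t)) \<longlongrightarrow> 0) at_top"
proof (rule dissipation_tendsto_0[where V = "\<lambda>t. (norm (\<Gamma> t - (ps, ms, zs)))\<^sup>2 / 2"])
  show "uniformly_continuous_on {0..} (\<lambda>t. W (p t) (m t) (z t))"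
  proof -
    obtain R where R: "\<And>t. 0 \<le> t \<Longrightarrow> norm (\<Gamma> t) \<le> R" using bounded_\<Gamma> by blast
    have "uniformly_continuous_on (cball 0 R) (\<lambda>x. W (fst x) (fst (snd x)) (snd (snd x)))"
      unfolding W_def by (rule compact_uniformly_continuous) (intro continuous_intros continuous_L compact_cball)+
    moreover have sub: "\<Gamma> ` {0..} \<subseteq> cball 0 R" using R by auto
    ultimately have "uniformly_continuous_on (\<Gamma> ` {0..}) (\<lambda>x. W (fst x) (fst (snd x)) (snd (snd x)))"
      unfolding uniformly_continuous_on_def by (meson sub subsetD)
    from uniformly_continuous_on_compose[OF uniformly_continuous_on_\<Gamma> this]
    show ?thesis by (simp add: \<Gamma>_def)
  qed
  show "0 \<le> W (p t) (m t) (z t)" for t by (rule W_nonneg)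
  show "(norm (\<Gamma> t - (ps, ms, zs)))\<^sup>2 / 2 - (norm (\<Gamma> s - (ps, ms, zs)))\<^sup>2 / 2 \<le> - c * (t - s)"
    if "0 \<le> s" "s \<le> t" "\<And>r. s \<le> r \<Longrightarrow> r \<le> t \<Longrightarrow> c \<le> W (p r) (m r) (z r)" for s t c
    using that by (rule dissipation)
  show "0 \<le> (norm (\<Gamma> t - (ps, ms, zs)))\<^sup>2 / 2" for t
    by (intro divide_nonneg_nonneg zero_le_power2) simp
qed

lemma z_tendsto: "(z \<longlongrightarrow> zs) at_top"
proof -
  have "((\<lambda>t. (norm (z t - zs))\<^sup>2) \<longlongrightarrow> 0) at_top"
  proof (rule tendsto_sandwich[OF _ _ tendsto_const])
    have "(norm (z t - zs))\<^sup>2 \<le> W (p t) (m t) (z t) / \<kappa>" for t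
      using W_lower[of "p t" "z t" "m t"] psd_B[of "p t"] \<kappa> by (simp add: field_simps)
    then show "\<forall>\<^sub>F t in at_top. (norm (z t - zs))\<^sup>2 \<le> W (p t) (m t) (z t) / \<kappa>" by simp
    show "((\<lambda>t. W (p t) (m t) (z t) / \<kappa>) \<longlongrightarrow> 0) at_top"
      using tendsto_divide_zero[OF W_tendsto_0] .
  qed simp
  then have "((\<lambda>t. sqrt ((norm (z t - zs))\<^sup>2)) \<longlongrightarrow> sqrt 0) at_top" by (rule tendsto_real_sqrt)
  then have "((\<lambda>t. z t - zs) \<longlongrightarrow> 0) at_top" by (simp add: tendsto_norm_zero_iff)
  then show ?thesis by (rule LIM_zero_cancel)
qed

text \<open>Semidefiniteness is tested at \<open>q - (1 / K) *\<^sub>R B q\<close>, a gradient step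
  for the form with the reciprocal of the norm bound as step size. It yields that
  \<open>p \<bullet> B p\<close>, which \<open>W\<close> controls, in turn controls
  \<open>B p\<close>.\<close>

lemma B_sq_le: "\<exists>K>0. \<forall>q. (norm (B q))\<^sup>2 \<le> K * (q \<bullet> B q)"
proof -
  obtain K where K: "K > 0" "\<And>q. norm (B q) \<le> norm q * K" using B.pos_bounded by blast
  have "(norm (B q))\<^sup>2 \<le> K * (q \<bullet> B q)" for q
  proof -
    define w where "w = B q"
    have "0 \<le> (q - (1 / K) *\<^sub>R w) \<bullet> B (q - (1 / K) *\<^sub>R w)" by (rule psd_B)
    also have "\<dots> = q \<bullet> B q - (1 / K) * (q \<bullet> B w) - (1 / K) * (w \<bullet> B q) + (1 / K) * (1 / K) * (w \<bullet> B w)"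
      by (simp add: B.diff B.scaleR inner_diff_left inner_diff_right algebra_simps)
    also have "q \<bullet> B w = w \<bullet> w" using sym_B[of q w] by (simp add: w_def)
    also have "w \<bullet> B q = w \<bullet> w" by (simp add: w_def)
    also have "w \<bullet> B w \<le> K * (w \<bullet> w)"
      using norm_cauchy_schwarz[of w "B w"] mult_left_mono[OF K(2)[of w] norm_ge_zero[of w]]
      by (simp add: power2_norm_eq_inner[symmetric] power2_eq_square mult_ac)
    then have "(1 / K) * (1 / K) * (w \<bullet> B w) \<le> (1 / K) * (1 / K) * (K * (w \<bullet> w))"
      by (intro mult_left_mono) auto
    finally have "0 \<le> q \<bullet> B q - (1 / K) * (w \<bullet> w)" using K(1) by (simp add: field_simps)
    then have "w \<bullet> w \<le> K * (q \<bullet> B q)" using K(1) by (simp add: field_simps)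
    then show ?thesis by (simp add: power2_norm_eq_inner w_def)
  qed
  then show ?thesis using K(1) by blast
qed

lemma B_tendsto_0: "((\<lambda>t. B (p t)) \<longlongrightarrow> 0) at_top"
proof -
  obtain K where K: "K > 0" "\<And>q. (norm (B q))\<^sup>2 \<le> K * (q \<bullet> B q)" using B_sq_le by blast
  have "((\<lambda>t. (norm (B (p t)))\<^sup>2) \<longlongrightarrow> 0) at_top"
  proof (rule tendsto_sandwich[OF _ _ tendsto_const])
    have "(norm (B (p t)))\<^sup>2 \<le> 2 * K * W (p t) (m t) (z t)" for t
    proof -
      have "0 \<le> \<kappa> * (norm (z t - zs))\<^sup>2" using \<kappa> by simp
      then have "p t \<bullet> B (p t) \<le> 2 * W (p t) (m t) (z t)"
        using W_lower[of "p t" "z t" "m t"] by linarith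
      then have "K * (p t \<bullet> B (p t)) \<le> K * (2 * W (p t) (m t) (z t))"
        using K(1) by (intro mult_left_mono) auto
      then show ?thesis using K(2)[of "p t"] by simp
    qed
    then show "\<forall>\<^sub>F t in at_top. (norm (B (p t)))\<^sup>2 \<le> 2 * K * W (p t) (m t) (z t)" by simp
    show "((\<lambda>t. 2 * K * W (p t) (m t) (z t)) \<longlongrightarrow> 0) at_top"
      using tendsto_mult_right_zero[OF W_tendsto_0] .
  qed simp
  then have "((\<lambda>t. sqrt ((norm (B (p t)))\<^sup>2)) \<longlongrightarrow> sqrt 0) at_top" by (rule tendsto_real_sqrt)
  then show ?thesis by (simp add: tendsto_norm_zero_iff)
qed

text \<open>The deviation from the saddle value splits into three parts: changing \<open>p\<close>
  at fixed duals \<open>(ms, zs)\<close>, squeezed between 0 and \<open>W\<close>; changing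
  \<open>zs\<close> to \<open>z\<close>; and \<open>(m - ms) \<bullet> B p\<close>, a bounded factor
  times one tending to 0.\<close>

lemma L_tendsto: "((\<lambda>t. L (p t) (m t) (z t)) \<longlongrightarrow> L ps ms zs) at_top"
proof -
  obtain R0 where R0: "\<And>t. 0 \<le> t \<Longrightarrow> norm (\<Gamma> t) \<le> R0" using bounded_\<Gamma> by blast
  define R where "R = max R0 (norm zs)"
  have R: "norm (p t) \<le> R" "norm (m t) \<le> R" "norm (z t) \<le> R" if "0 \<le> t" for t
    using norm_le_\<Gamma>[of t] R0[OF that] by (auto simp: R_def)
  have "((\<lambda>t. L (p t) ms zs - L ps ms zs) \<longlongrightarrow> 0) at_top"
  proof (rule tendsto_sandwich[OF _ _ tendsto_const W_tendsto_0])
    show "\<forall>\<^sub>F t in at_top. L (p t) ms zs - L ps ms zs \<le> W (p t) (m t) (z t)"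
      by (intro always_eventually allI W_ge_gap)
    have "0 \<le> L (p t) ms zs - L ps ms zs" for t
      using quad_growth[of "p t"] psd_B[of "p t"] by simp
    then show "\<forall>\<^sub>F t in at_top. 0 \<le> L (p t) ms zs - L ps ms zs" by simp
  qed
  moreover have "((\<lambda>t. \<Phi> (p t) (z t) - \<Phi> (p t) zs) \<longlongrightarrow> 0) at_top"
  proof (rule tendstoI)
    fix e :: real assume "e > 0"
    \<comment> \<open>Convergence of \<open>p\<close> is not yet known, so continuity in
      \<open>z\<close> has to be uniform over the compact range of \<open>p\<close>;
      \<open>R\<close> also bounds \<open>norm zs\<close> for this purpose.\<close>
    have "uniformly_continuous_on (cball 0 R \<times> cball 0 R) (\<lambda>(q, y). \<Phi> q y)"
      by (rule compact_uniformly_continuous) (auto intro: continuous_on_subset[OF cont_\<Phi>] compact_Times)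
    then obtain d where "d > 0" and d: "\<And>a b. a \<in> cball 0 R \<times> cball 0 R \<Longrightarrow> b \<in> cball 0 R \<times> cball 0 R \<Longrightarrow>
        dist b a < d \<Longrightarrow> dist (case b of (q, y) \<Rightarrow> \<Phi> q y) (case a of (q, y) \<Rightarrow> \<Phi> q y) < e"
      using \<open>e > 0\<close> unfolding uniformly_continuous_on_def by meson
    have "\<forall>\<^sub>F t in at_top. dist (z t) zs < d" using tendstoD[OF z_tendsto \<open>d > 0\<close>] .
    moreover have "\<forall>\<^sub>F t :: real in at_top. 0 \<le> t" by (rule eventually_ge_at_top)
    ultimately show "\<forall>\<^sub>F t in at_top. dist (\<Phi> (p t) (z t) - \<Phi> (p t) zs) 0 < e"
    proof eventually_elim
      case (elim t)
      have "dist (p t, z t) (p t, zs) < d" using elim by (simp add: dist_Pair_Pair)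
      then show ?case
        using d[of "(p t, zs)" "(p t, z t)"] R[OF elim(2)] by (simp add: R_def dist_norm)
    qed
  qed
  moreover have "((\<lambda>t. (m t - ms) \<bullet> B (p t)) \<longlongrightarrow> 0) at_top"
  proof (rule Lim_null_comparison)
    show "((\<lambda>t. (R + norm ms) * norm (B (p t))) \<longlongrightarrow> 0) at_top"
      by (rule tendsto_mult_right_zero[OF tendsto_norm_zero[OF B_tendsto_0]])
    show "\<forall>\<^sub>F t in at_top. norm ((m t - ms) \<bullet> B (p t)) \<le> (R + norm ms) * norm (B (p t))"
      using eventually_ge_at_top[of 0]
    proof eventually_elim
      case (elim t)
      have "\<bar>(m t - ms) \<bullet> B (p t)\<bar> \<le> norm (m t - ms) * norm (B (p t))" by (rule Cauchy_Schwarz_ineq2)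
      also have "\<dots> \<le> (R + norm ms) * norm (B (p t))"
        using norm_triangle_ineq4[of "m t" ms] R(2)[OF elim] by (intro mult_right_mono) auto
      finally show ?case by simp
    qed
  qed
  ultimately have "((\<lambda>t. (L (p t) ms zs - L ps ms zs) + (\<Phi> (p t) (z t) - \<Phi> (p t) zs) + (m t - ms) \<bullet> B (p t))
      \<longlongrightarrow> 0 + 0 + 0) at_top"
    by (intro tendsto_add)
  moreover have "(L (p t) ms zs - L ps ms zs) + (\<Phi> (p t) (z t) - \<Phi> (p t) zs) + (m t - ms) \<bullet> B (p t)
      = L (p t) (m t) (z t) - L ps ms zs" for t
    by (simp add: L_eq inner_diff_left)
  ultimately have "((\<lambda>t. L (p t) (m t) (z t) - L ps ms zs) \<longlongrightarrow> 0) at_top" by simp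
  then show ?thesis by (rule LIM_zero_cancel)
qed

section \<open>Limit points of the trajectory are saddle points\<close>

lemma limit_point_minimizes:
  assumes T: "filterlim T at_top sequentially" and mb: "(\<lambda>k. m (T k)) \<longlonglongrightarrow> mb" and q: "q \<in> C"
  shows "L ps ms zs \<le> L q mb zs"
proof (rule ccontr)
  assume "\<not> L ps ms zs \<le> L q mb zs"
  \<comment> \<open>Of the gap \<open>3 * e\<close>, one \<open>e\<close> is spent on replacing
    \<open>(m, z)\<close> by \<open>(mb, zs)\<close> and one on the convergence of \<open>L\<close>
    along the trajectory; a decrease at rate \<open>2 * e\<close> of the squared distance to
    \<open>q\<close> remains.\<close>
  define e where "e = (L ps ms zs - L q mb zs) / 3"
  have "e > 0" using \<open>\<not> _\<close> by (simp add: e_def)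
  obtain R where R: "\<And>t. 0 \<le> t \<Longrightarrow> norm (\<Gamma> t) \<le> R" using bounded_\<Gamma> by blast
  \<comment> \<open>Long enough that the forced decrease \<open>2 * e * S\<close> exceeds every
    possible value of the squared distance from the trajectory to \<open>q\<close>.\<close>
  define S where "S = (R + norm q)\<^sup>2 / (2 * e) + 1"
  have "S > 0" using \<open>e > 0\<close> by (auto simp: S_def intro!: add_nonneg_pos)
  have "continuous_on UNIV (\<lambda>x. L q (fst x) (snd x))" by (intro continuous_L continuous_intros)
  then obtain d where "d > 0" and d0: "\<And>x. dist x (mb, zs) < d \<Longrightarrow> dist (L q (fst x) (snd x)) (L q mb zs) < e"
    using \<open>e > 0\<close> unfolding continuous_on_iff by (metis UNIV_I fst_conv snd_conv)
  have d: "L q n y < L q mb zs + e" if "norm (n - mb) < d / 2" "norm (y - zs) < d / 2" for n y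
  proof -
    have "dist (n, y) (mb, zs) < d"
      using that norm_Pair_le[of "n - mb" "y - zs"] by (simp add: dist_norm)
    then show ?thesis using d0[of "(n, y)"] by (auto simp: dist_real_def)
  qed
  have "\<forall>\<^sub>F t in at_top. dist (L (p t) (m t) (z t)) (L ps ms zs) < e" using tendstoD[OF L_tendsto \<open>e > 0\<close>] .
  moreover have "\<forall>\<^sub>F t in at_top. dist (z t) zs < d / 2" using tendstoD[OF z_tendsto, of "d / 2"] \<open>d > 0\<close> by simp
  \<comment> \<open>This speed limit keeps the drift of the multipliers over the long window within
    \<open>d / 4\<close>; \<open>p\<close> may move freely.\<close>
  moreover have "\<forall>\<^sub>F t in at_top. dist (B (p t)) 0 < d / (4 * S)"
    using tendstoD[OF B_tendsto_0] \<open>d > 0\<close> \<open>S > 0\<close> by simp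
  ultimately have "\<forall>\<^sub>F t in at_top. L (p t) (m t) (z t) > L ps ms zs - e \<and> norm (z t - zs) < d / 2 \<and>
      norm (B (p t)) < d / (4 * S)"
    by eventually_elim (auto simp: dist_norm abs_if split: if_splits)
  then obtain t0 where t0: "\<And>t. t \<ge> t0 \<Longrightarrow> L (p t) (m t) (z t) > L ps ms zs - e \<and> norm (z t - zs) < d / 2 \<and>
      norm (B (p t)) < d / (4 * S)"
    unfolding eventually_at_top_linorder by blast
  have "\<forall>\<^sub>F k in sequentially. max t0 0 \<le> T k" using T unfolding filterlim_at_top by blast
  moreover have "\<forall>\<^sub>F k in sequentially. dist (m (T k)) mb < d / 4" using tendstoD[OF mb, of "d / 4"] \<open>d > 0\<close> by simp
  ultimately have "\<forall>\<^sub>F k in sequentially. max t0 0 \<le> T k \<and> dist (m (T k)) mb < d / 4" by (rule eventually_conj)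
  then obtain k where k: "max t0 0 \<le> T k" "norm (m (T k) - mb) < d / 4"
    unfolding eventually_sequentially dist_norm by blast
  define t where "t = T k"
  have t: "t0 \<le> t" "0 \<le> t" "norm (m t - mb) < d / 4" using k by (auto simp: t_def)
  have gap: "L q (m r) (z r) - L (p r) (m r) (z r) \<le> - e" if r: "t \<le> r" "r \<le> t + S" for r
  proof -
    have "norm (m r - m t) \<le> d / (4 * S) * (r - t)"
      by (rule m_increment) (use t r t0 in \<open>auto intro!: less_imp_le\<close>)
    also have "\<dots> \<le> d / (4 * S) * S" using r \<open>d > 0\<close> \<open>S > 0\<close> by (intro mult_left_mono) auto
    finally have "norm (m r - m t) \<le> d / 4" using \<open>S > 0\<close> by simp
    then have "norm (m r - mb) < d / 2"
      using norm_triangle_ineq[of "m r - m t" "m t - mb"] t(3) by simp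
    then have "L q (m r) (z r) < L q mb zs + e" using t0[of r] t r by (intro d) auto
    moreover have "L (p r) (m r) (z r) > L ps ms zs - e" using t0[of r] t r by auto
    ultimately show ?thesis by (simp add: e_def field_simps)
  qed
  have "(norm (p (t + S) - q))\<^sup>2 - (norm (p t - q))\<^sup>2 \<le> 2 * (- e) * ((t + S) - t)"
    by (rule p_increment[OF t(2) _ q gap]) (use \<open>S > 0\<close> in auto)
  moreover have "(norm (p t - q))\<^sup>2 \<le> (R + norm q)\<^sup>2"
    using norm_triangle_ineq4[of "p t" q] norm_le_\<Gamma>(1)[of t] R[OF t(2)] by (intro power_mono) auto
  moreover have "0 \<le> (norm (p (t + S) - q))\<^sup>2" by simp
  moreover have "2 * (- e) * ((t + S) - t) = - (2 * e * S)" by simp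
  ultimately have "2 * e * S \<le> (R + norm q)\<^sup>2" by linarith
  moreover have "2 * e * S = (R + norm q)\<^sup>2 + 2 * e" using \<open>e > 0\<close> by (simp add: S_def field_simps)
  ultimately show False using \<open>e > 0\<close> by simp
qed

lemma limit_point_maximizes:
  assumes T: "filterlim T at_top sequentially" and pb: "(\<lambda>k. p (T k)) \<longlonglongrightarrow> pb"
  shows "\<Phi> pb y \<le> \<Phi> pb zs"
proof (rule ccontr)
  assume "\<not> \<Phi> pb y \<le> \<Phi> pb zs"
  \<comment> \<open>The difference is \<open>- 2 * e\<close> at the limit point and stays below
    \<open>- e\<close> nearby.\<close>
  define e where "e = (\<Phi> pb y - \<Phi> pb zs) / 2"
  have "e > 0" using \<open>\<not> _\<close> by (simp add: e_def)
  obtain M where M: "0 \<le> M" "\<And>s t. 0 \<le> s \<Longrightarrow> s \<le> t \<Longrightarrow> norm (\<Gamma> t - \<Gamma> s) \<le> M * (t - s)"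
    using lipschitz_\<Gamma> by blast
  have "continuous_on UNIV (\<lambda>x. \<Phi> (fst x) (snd x) - \<Phi> (fst x) y)" by (intro continuous_\<Phi> continuous_intros)
  then obtain d where "d > 0" and d0: "\<And>x. dist x (pb, zs) < d \<Longrightarrow>
      dist (\<Phi> (fst x) (snd x) - \<Phi> (fst x) y) (\<Phi> pb zs - \<Phi> pb y) < e"
    using \<open>e > 0\<close> unfolding continuous_on_iff by (metis UNIV_I fst_conv snd_conv)
  have d: "\<Phi> q w - \<Phi> q y < - e" if "norm (q - pb) < d / 2" "norm (w - zs) < d / 2" for q w
  proof -
    have "dist (q, w) (pb, zs) < d"
      using that norm_Pair_le[of "q - pb" "w - zs"] by (simp add: dist_norm)
    then have "\<Phi> q w - \<Phi> q y < \<Phi> pb zs - \<Phi> pb y + e" using d0[of "(q, w)"] by (auto simp: dist_real_def)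
    also have "\<dots> = - e" by (simp add: e_def field_simps)
    finally show ?thesis .
  qed
  \<comment> \<open>The Lipschitz constant \<open>M\<close> then lets \<open>p\<close> move by at
    most \<open>d / 4\<close> during the window; the summand 1 guards against
    \<open>M = 0\<close>.\<close>
  define S where "S = d / (4 * (M + 1))"
  have "S > 0" using \<open>d > 0\<close> M(1) by (simp add: S_def)
  have MS: "M * S \<le> d / 4"
  proof -
    have "M * S \<le> (M + 1) * S" using \<open>S > 0\<close> by simp
    also have "\<dots> = d / 4" using M(1) by (simp add: S_def field_simps)
    finally show ?thesis .
  qed
  have "((\<lambda>t. (norm (z t - y))\<^sup>2) \<longlongrightarrow> (norm (zs - y))\<^sup>2) at_top" by (intro tendsto_intros z_tendsto)
  \<comment> \<open>Both ends of the window lie strictly within this tolerance of the limit, so the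
    squared distance changes by less than \<open>2 * e * S\<close>, just the decrease that the gap
    would force.\<close>
  moreover have "e * S > 0" using \<open>e > 0\<close> \<open>S > 0\<close> by simp
  ultimately have "\<forall>\<^sub>F t in at_top. dist ((norm (z t - y))\<^sup>2) ((norm (zs - y))\<^sup>2) < e * S" by (rule tendstoD)
  moreover have "\<forall>\<^sub>F t in at_top. dist (z t) zs < d / 2" using tendstoD[OF z_tendsto, of "d / 2"] \<open>d > 0\<close> by simp
  ultimately have "\<forall>\<^sub>F t in at_top. \<bar>(norm (z t - y))\<^sup>2 - (norm (zs - y))\<^sup>2\<bar> < e * S \<and> norm (z t - zs) < d / 2"
    by eventually_elim (simp add: dist_real_def dist_norm[of "z _"])
  then obtain t0 where t0: "\<And>t. t \<ge> t0 \<Longrightarrow>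
      \<bar>(norm (z t - y))\<^sup>2 - (norm (zs - y))\<^sup>2\<bar> < e * S \<and> norm (z t - zs) < d / 2"
    unfolding eventually_at_top_linorder by blast
  have "\<forall>\<^sub>F k in sequentially. max t0 0 \<le> T k" using T unfolding filterlim_at_top by blast
  moreover have "\<forall>\<^sub>F k in sequentially. dist (p (T k)) pb < d / 4" using tendstoD[OF pb, of "d / 4"] \<open>d > 0\<close> by simp
  ultimately have "\<forall>\<^sub>F k in sequentially. max t0 0 \<le> T k \<and> dist (p (T k)) pb < d / 4" by (rule eventually_conj)
  then obtain k where k: "max t0 0 \<le> T k" "norm (p (T k) - pb) < d / 4"
    unfolding eventually_sequentially dist_norm by blast
  define t where "t = T k"
  have t: "t0 \<le> t" "0 \<le> t" "norm (p t - pb) < d / 4" using k by (auto simp: t_def)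
  have gap: "\<Phi> (p r) (z r) - \<Phi> (p r) y \<le> - e" if r: "t \<le> r" "r \<le> t + S" for r
  proof -
    have "norm (p r - p t) \<le> norm (\<Gamma> r - \<Gamma> t)"
      using norm_fst_le[of "p r - p t" "(m r - m t, z r - z t)"] by (simp add: \<Gamma>_def)
    also have "\<dots> \<le> M * (r - t)" using M(2) t r by auto
    also have "\<dots> \<le> M * S" using r M(1) by (intro mult_left_mono) auto
    finally have "norm (p r - pb) < d / 2"
      using norm_triangle_ineq[of "p r - p t" "p t - pb"] t(3) MS by simp
    then show ?thesis using d[of "p r" "z r"] t0[of r] t r by simp
  qed
  have "(norm (z (t + S) - y))\<^sup>2 - (norm (z t - y))\<^sup>2 \<le> 2 * (- e) * ((t + S) - t)"
    by (rule z_increment[OF t(2) _ gap]) (use \<open>S > 0\<close> in auto)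
  moreover have "\<bar>(norm (z t - y))\<^sup>2 - (norm (zs - y))\<^sup>2\<bar> < e * S"
    "\<bar>(norm (z (t + S) - y))\<^sup>2 - (norm (zs - y))\<^sup>2\<bar> < e * S"
    using t0[of t] t0[of "t + S"] t(1) \<open>S > 0\<close> by auto
  moreover have "2 * (- e) * ((t + S) - t) = - (e * S) - e * S" by simp
  ultimately show False by linarith
qed

text \<open>Reapplying \<open>\<Gamma>_increment\<close> at the limit point uses only its saddle
  inequalities, so \<open>pb\<close> may lie on the boundary of \<open>C\<close>. The common value
  is recorded because optimality for (D) is inferred by comparison with the given interior saddle
  point.\<close>

lemma convergence:
  obtains pb mb where "pb \<in> C" "(p \<longlongrightarrow> pb) at_top" "(m \<longlongrightarrow> mb) at_top" "B pb = 0"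
    "\<And>n y. L pb n y \<le> L pb mb zs" "\<And>q. q \<in> C \<Longrightarrow> L pb mb zs \<le> L q mb zs"
    "L pb mb zs = L ps ms zs"
proof -
  obtain R where R: "\<And>t. 0 \<le> t \<Longrightarrow> norm (\<Gamma> t) \<le> R" using bounded_\<Gamma> by blast
  have "\<forall>k. \<Gamma> (real k) \<in> cball 0 R" using R by simp
  then obtain lb \<rho> where \<rho>: "strict_mono (\<rho> :: nat \<Rightarrow> nat)" "((\<lambda>k. \<Gamma> (real k)) \<circ> \<rho>) \<longlonglongrightarrow> lb"
    using compact_cball[of "0 :: 'a \<times> 'a \<times> 'b" R] unfolding compact_def by meson
  define pb mb zb where "pb = fst lb" and "mb = fst (snd lb)" and "zb = snd (snd lb)"
  have lb: "lb = (pb, mb, zb)" by (simp add: pb_def mb_def zb_def)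
  define T where "T k = real (\<rho> k)" for k
  have T: "filterlim T at_top sequentially"
    unfolding T_def using filterlim_compose[OF filterlim_real_sequentially filterlim_subseq[OF \<rho>(1)]] .
  have \<Gamma>T: "(\<lambda>k. \<Gamma> (T k)) \<longlonglongrightarrow> lb" using \<rho>(2) by (simp add: o_def T_def)
  have pT: "(\<lambda>k. p (T k)) \<longlonglongrightarrow> pb" and mT: "(\<lambda>k. m (T k)) \<longlonglongrightarrow> mb" and zT: "(\<lambda>k. z (T k)) \<longlonglongrightarrow> zb"
    using tendsto_fst[OF \<Gamma>T] tendsto_fst[OF tendsto_snd[OF \<Gamma>T]] tendsto_snd[OF tendsto_snd[OF \<Gamma>T]]
    by (simp_all add: \<Gamma>_def pb_def mb_def zb_def)
  have "zb = zs" using LIMSEQ_unique[OF zT filterlim_compose[OF z_tendsto T]] .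
  have "pb \<in> C"
    by (rule Lim_in_closed_set[OF closed_C _ _ pT]) (auto simp: T_def intro!: always_eventually p_in_C)
  have "(\<lambda>k. B (p (T k))) \<longlonglongrightarrow> B pb" using pT by (rule B.tendsto)
  then have "B pb = 0" using filterlim_compose[OF B_tendsto_0 T] by (rule LIMSEQ_unique)
  have "(\<lambda>k. L (p (T k)) (m (T k)) (z (T k))) \<longlonglongrightarrow> L pb mb zs"
    using tendsto_L[OF pT mT zT] \<open>zb = zs\<close> by simp
  then have val: "L pb mb zs = L ps ms zs" using filterlim_compose[OF L_tendsto T] by (rule LIMSEQ_unique)
  have min: "L pb mb zs \<le> L q mb zs" if "q \<in> C" for q
    unfolding val by (rule limit_point_minimizes[OF T mT that])
  \<comment> \<open>As \<open>B pb = 0\<close>, the multiplier disappears and maximality is a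
    statement about \<Phi> alone.\<close>
  have max: "L pb n y \<le> L pb mb zs" for n y
    using limit_point_maximizes[OF T pT, of y] by (simp add: L_eq \<open>B pb = 0\<close>)
  have "(\<Gamma> \<longlongrightarrow> (pb, mb, zs)) at_top"
  proof (rule tendstoI)
    fix e :: real assume "e > 0"
    then have "\<forall>\<^sub>F k in sequentially. dist (\<Gamma> (T k)) (pb, mb, zs) < e"
      using tendstoD[OF \<Gamma>T] lb \<open>zb = zs\<close> by simp
    then obtain k where k: "norm (\<Gamma> (T k) - (pb, mb, zs)) < e"
      unfolding eventually_sequentially dist_norm by blast
    have "dist (\<Gamma> t) (pb, mb, zs) < e" if "T k \<le> t" for t
    proof -
      have "(norm (\<Gamma> t - (pb, mb, zs)))\<^sup>2 - (norm (\<Gamma> (T k) - (pb, mb, zs)))\<^sup>2 \<le> 2 * 0 * (t - T k)"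
      proof (rule \<Gamma>_increment[OF _ that \<open>pb \<in> C\<close>])
        fix r assume "T k \<le> r" "r \<le> t"
        moreover have "0 \<le> T k" by (simp add: T_def)
        ultimately have "p r \<in> C" by (intro p_in_C) auto
        then show "L pb (m r) (z r) - L (p r) mb zs \<le> 0" using min[of "p r"] max[of "m r" "z r"] by simp
      qed (simp add: T_def)
      then have "norm (\<Gamma> t - (pb, mb, zs)) \<le> norm (\<Gamma> (T k) - (pb, mb, zs))"
        by (intro power2_le_imp_le[OF _ norm_ge_zero]) linarith
      then show ?thesis using k unfolding dist_norm by linarith
    qed
    then show "\<forall>\<^sub>F t in at_top. dist (\<Gamma> t) (pb, mb, zs) < e"
      unfolding eventually_at_top_linorder by blast
  qed
  then have "(p \<longlongrightarrow> pb) at_top" "(m \<longlongrightarrow> mb) at_top"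
    using tendsto_fst[of \<Gamma>] tendsto_fst[OF tendsto_snd[of \<Gamma>]] by (force simp: \<Gamma>_def)+
  then show thesis using that \<open>pb \<in> C\<close> \<open>B pb = 0\<close> max min val by blast
qed

end

subsection \<open>Gradients and convexity\<close>

lemma gradient_eqI: "GDERIV \<phi> z :> D \<Longrightarrow> gradient \<phi> z = D"
  unfolding gradient_def gderiv_def
proof (rule the_equality)
  fix D' assume "(\<phi> has_derivative (\<lambda>h. h \<bullet> D)) (at z)" "(\<phi> has_derivative (\<lambda>h. h \<bullet> D')) (at z)"
  then have "(\<lambda>h. h \<bullet> D) = (\<lambda>h. h \<bullet> D')" by (rule has_derivative_unique)
  then have "\<forall>h. h \<bullet> D = h \<bullet> D'" by (simp add: fun_eq_iff)
  then show "D' = D" unfolding vector_eq_ldot by simp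
qed

text \<open>Riesz representation: the coordinates of the gradient are the values of the derivative
  on the basis.\<close>

lemma differentiable_imp_GDERIV_gradient:
  fixes \<phi> :: "'a::euclidean_space \<Rightarrow> real"
  assumes "\<phi> differentiable (at z)"
  shows "GDERIV \<phi> z :> gradient \<phi> z"
proof -
  obtain \<phi>' where \<phi>': "(\<phi> has_derivative \<phi>') (at z)" using assms unfolding differentiable_def by blast
  then have lin: "linear \<phi>'" by (rule has_derivative_linear)
  have "\<phi>' = (\<lambda>h. h \<bullet> (\<Sum>b\<in>Basis. \<phi>' b *\<^sub>R b))"
  proof
    fix w
    have "\<phi>' w = \<phi>' (\<Sum>b\<in>Basis. (w \<bullet> b) *\<^sub>R b)" by (simp add: euclidean_representation)
    also have "\<dots> = (\<Sum>b\<in>Basis. (w \<bullet> b) * \<phi>' b)" by (simp add: linear_sum[OF lin] linear_scale[OF lin])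
    also have "\<dots> = w \<bullet> (\<Sum>b\<in>Basis. \<phi>' b *\<^sub>R b)" by (simp add: inner_sum_right mult.commute)
    finally show "\<phi>' w = w \<bullet> (\<Sum>b\<in>Basis. \<phi>' b *\<^sub>R b)" .
  qed
  then have "GDERIV \<phi> z :> (\<Sum>b\<in>Basis. \<phi>' b *\<^sub>R b)" using \<phi>' by (simp add: gderiv_def)
  then show ?thesis using gradient_eqI by metis
qed

text \<open>Both functions have the same candidate gradients, so the definite descriptions agree; no
  differentiability enters.\<close>

lemma gradient_add_const: "gradient (\<lambda>y. \<phi> y + c) z = gradient \<phi> z"
proof -
  have "GDERIV (\<lambda>y. \<phi> y + c) z :> D \<longleftrightarrow> GDERIV \<phi> z :> D" for D
    using has_derivative_add_const[of \<phi> _ "at z" c] has_derivative_add_const[of "\<lambda>y. \<phi> y + c" _ "at z" "- c"]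
    unfolding gderiv_def by auto
  then show ?thesis by (simp add: gradient_def)
qed

lemma gradient_inner_left: "gradient (\<lambda>y. y \<bullet> w) z = w"
  by (rule gradient_eqI) (simp add: gderiv_def bounded_linear_imp_has_derivative bounded_linear_inner_left)

text \<open>The dynamics is written with separate gradients in \<open>x\<close> and
  \<open>l\<close>, whereas the convexity inequality needs the joint one; \<open>GDERIV_vec\<close>
  plays the same part for the blocks of \<xi>.\<close>

lemma GDERIV_Pair:
  fixes \<psi> :: "'a::euclidean_space \<times> 'b::euclidean_space \<Rightarrow> real"
  assumes "\<psi> differentiable (at (a, b))"
  shows "GDERIV \<psi> (a, b) :> (gradient (\<lambda>y. \<psi> (y, b)) a, gradient (\<lambda>y. \<psi> (a, y)) b)"
proof -
  define D where "D = gradient \<psi> (a, b)"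
  have D: "(\<psi> has_derivative (\<lambda>h. h \<bullet> D)) (at (a, b))"
    using differentiable_imp_GDERIV_gradient[OF assms] by (simp add: gderiv_def D_def)
  have "((\<lambda>y. \<psi> (y, b)) has_derivative (\<lambda>h. (h, 0) \<bullet> D)) (at a)"
    by (rule has_derivative_compose[where f = "\<lambda>y. (y, b)" and g = \<psi>]) (auto intro!: derivative_eq_intros D)
  then have "gradient (\<lambda>y. \<psi> (y, b)) a = fst D"
    by (intro gradient_eqI) (simp add: gderiv_def inner_prod_def)
  moreover have "((\<lambda>y. \<psi> (a, y)) has_derivative (\<lambda>h. (0, h) \<bullet> D)) (at b)"
    by (rule has_derivative_compose[where f = "\<lambda>y. (a, y)" and g = \<psi>]) (auto intro!: derivative_eq_intros D)
  then have "gradient (\<lambda>y. \<psi> (a, y)) b = snd D"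
    by (intro gradient_eqI) (simp add: gderiv_def inner_prod_def)
  ultimately show ?thesis using D by (simp add: gderiv_def)
qed

lemma GDERIV_vec:
  fixes \<psi> :: "('a::euclidean_space)^'k::finite \<Rightarrow> real"
  assumes "\<psi> differentiable (at z)"
  shows "GDERIV \<psi> z :> (\<chi> k. gradient (\<lambda>y. \<psi> (\<chi> j. if j = k then y else z $ j)) (z $ k))"
proof -
  define D where "D = gradient \<psi> z"
  have D: "(\<psi> has_derivative (\<lambda>h. h \<bullet> D)) (at z)"
    using differentiable_imp_GDERIV_gradient[OF assms] by (simp add: gderiv_def D_def)
  have "gradient (\<lambda>y. \<psi> (\<chi> j. if j = k then y else z $ j)) (z $ k) = D $ k" for k
  proof (rule gradient_eqI)
    have bl: "bounded_linear (\<lambda>w::'a. axis k w :: 'a^'k)"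
      by (auto simp: linear_conv_bounded_linear[symmetric] linear_iff vec_eq_iff axis_def)
    \<comment> \<open>Replacing one block is the linear embedding \<open>axis k\<close> followed by
      a translation.\<close>
    have eq: "(\<lambda>y. \<chi> j. if j = k then y else z $ j) = (\<lambda>y. axis k y + (z - axis k (z $ k)))"
      by (auto simp: vec_eq_iff axis_def fun_eq_iff)
    have "((\<lambda>y. \<chi> j. if j = k then y else z $ j) has_derivative axis k) (at (z $ k))"
      unfolding eq by (intro has_derivative_add_const bounded_linear_imp_has_derivative bl)
    moreover have "(\<psi> has_derivative (\<lambda>h. h \<bullet> D)) (at (\<chi> j. if j = k then z $ k else z $ j))"
    proof -
      have "(\<chi> j. if j = k then z $ k else z $ j) = z" by (simp add: vec_eq_iff)
      then show ?thesis using D by simp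
    qed
    ultimately have "((\<lambda>y. \<psi> (\<chi> j. if j = k then y else z $ j)) has_derivative (\<lambda>h. axis k h \<bullet> D)) (at (z $ k))"
      by (rule has_derivative_compose)
    moreover have "(\<lambda>h. axis k h \<bullet> D) = (\<lambda>h. h \<bullet> D $ k)"
      by (simp add: fun_eq_iff inner_axis inner_axis')
    ultimately show "GDERIV (\<lambda>y. \<psi> (\<chi> j. if j = k then y else z $ j)) (z $ k) :> D $ k"
      by (simp add: gderiv_def)
  qed
  then have "(\<chi> k. gradient (\<lambda>y. \<psi> (\<chi> j. if j = k then y else z $ j)) (z $ k)) = D"
    by (simp add: vec_eq_iff)
  then show ?thesis using D by (simp add: gderiv_def)
qed

lemma convex_on_gradient_inequality:
  assumes conv: "convex_on S \<phi>" and S: "y \<in> S" "y' \<in> S" and D: "GDERIV \<phi> y :> D"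
  shows "D \<bullet> (y' - y) \<le> \<phi> y' - \<phi> y"
proof -
  define w where "w = y' - y"
  have "((\<lambda>s. y + s *\<^sub>R w) has_derivative (\<lambda>s. s *\<^sub>R w)) (at (0::real))"
    by (auto intro!: derivative_eq_intros)
  moreover have "(\<phi> has_derivative (\<lambda>h. h \<bullet> D)) (at (y + 0 *\<^sub>R w))" using D by (simp add: gderiv_def)
  ultimately have "((\<lambda>s. \<phi> (y + s *\<^sub>R w)) has_derivative (\<lambda>s. (s *\<^sub>R w) \<bullet> D)) (at 0)"
    by (rule has_derivative_compose)
  then have "((\<lambda>s. \<phi> (y + s *\<^sub>R w)) has_field_derivative (w \<bullet> D)) (at 0)"
    by (simp add: has_field_derivative_def mult_commute_abs)
  then have "((\<lambda>s. (\<phi> (y + s *\<^sub>R w) - \<phi> y) / s) \<longlongrightarrow> w \<bullet> D) (at 0)"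
    by (simp add: has_field_derivative_iff)
  then have lim: "((\<lambda>s. (\<phi> (y + s *\<^sub>R w) - \<phi> y) / s) \<longlongrightarrow> w \<bullet> D) (at_right 0)"
    by (simp add: filterlim_at_split)
  have "(\<phi> (y + s *\<^sub>R w) - \<phi> y) / s \<le> \<phi> y' - \<phi> y" if "0 < s" "s < 1" for s
  proof -
    have "\<phi> ((1 - s) *\<^sub>R y + s *\<^sub>R y') \<le> (1 - s) * \<phi> y + s * \<phi> y'"
      using that S by (intro convex_onD[OF conv]) auto
    moreover have "(1 - s) *\<^sub>R y + s *\<^sub>R y' = y + s *\<^sub>R w" by (simp add: w_def algebra_simps)
    ultimately show ?thesis using that by (simp add: field_simps)
  qed
  then have "w \<bullet> D \<le> \<phi> y' - \<phi> y"
    by (intro tendsto_upperbound[OF lim]) (auto simp: eventually_at_right_field intro!: exI[of _ 1])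
  then show ?thesis by (simp add: w_def inner_commute)
qed

lemma strongly_concave_quadratic_growth:
  fixes \<phi> :: "'a::real_normed_vector \<Rightarrow> real"
  assumes "strongly_concave \<phi>" and max: "\<And>y. \<phi> y \<le> \<phi> y0"
  obtains c where "c > 0" "\<And>y. c * (norm (y - y0))\<^sup>2 \<le> \<phi> y0 - \<phi> y"
proof -
  obtain c where c: "c > 0" "\<And>y z t. t \<in> {0..1} \<Longrightarrow>
     (1 - t) * \<phi> y + t * \<phi> z + c / 2 * t * (1 - t) * (norm (y - z))\<^sup>2 \<le> \<phi> ((1 - t) *\<^sub>R y + t *\<^sub>R z)"
    using assms(1) unfolding strongly_concave_def by blast
  have "c / 4 * (norm (y - y0))\<^sup>2 \<le> \<phi> y0 - \<phi> y" for y
  proof -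
    \<comment> \<open>Testing at the midpoint gives the constant \<open>c / 4\<close> without any
      limit.\<close>
    have "(1 - 1 / 2) * \<phi> y + 1 / 2 * \<phi> y0 + c / 2 * (1 / 2) * (1 - 1 / 2) * (norm (y - y0))\<^sup>2
        \<le> \<phi> ((1 - 1 / 2) *\<^sub>R y + (1 / 2) *\<^sub>R y0)"
      by (rule c(2)) simp
    also have "\<dots> \<le> \<phi> y0" by (rule max)
    finally show ?thesis by (simp add: field_simps)
  qed
  then show thesis using that[of "c / 4"] c(1) by simp
qed

lemma has_vector_derivative_vec_nth:
  fixes \<gamma> :: "real \<Rightarrow> ('a::euclidean_space)^'k::finite"
  assumes "\<And>k. ((\<lambda>s. \<gamma> s $ k) has_vector_derivative D $ k) (at t within S)"
  shows "(\<gamma> has_vector_derivative D) (at t within S)"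
  unfolding has_vector_derivative_def
proof (subst has_derivative_componentwise_within, intro ballI)
  fix b :: "'a^'k" assume "b \<in> Basis"
  then obtain k u where b: "b = axis k u" by (auto simp: Basis_vec_def)
  have "((\<lambda>s. \<gamma> s $ k \<bullet> u) has_derivative (\<lambda>s. (s *\<^sub>R D $ k) \<bullet> u)) (at t within S)"
    using assms[of k] unfolding has_vector_derivative_def by (rule has_derivative_inner_left)
  then show "((\<lambda>s. \<gamma> s \<bullet> b) has_derivative (\<lambda>s. (s *\<^sub>R D) \<bullet> b)) (at t within S)"
    by (simp add: b inner_axis)
qed

lemma sum_coordinate_max:
  fixes \<phi> :: "'k::finite \<Rightarrow> 'a \<Rightarrow> real" and zs :: "'a^'k"
  assumes "\<And>z :: 'a^'k. (\<Sum>k\<in>UNIV. \<phi> k (z $ k)) \<le> (\<Sum>k\<in>UNIV. \<phi> k (zs $ k))"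
  shows "\<phi> k y \<le> \<phi> k (zs $ k)"
proof -
  define z where "z = (\<chi> j. if j = k then y else zs $ j)"
  have "(\<Sum>j\<in>UNIV. \<phi> j (z $ j)) = \<phi> k y + (\<Sum>j\<in>UNIV - {k}. \<phi> j (zs $ j))"
    by (subst sum.remove[of _ k]) (auto simp: z_def intro!: sum.cong)
  moreover have "(\<Sum>j\<in>UNIV. \<phi> j (zs $ j)) = \<phi> k (zs $ k) + (\<Sum>j\<in>UNIV - {k}. \<phi> j (zs $ j))"
    by (subst sum.remove[of _ k]) auto
  ultimately show ?thesis using assms[of z] by simp
qed

lemma psd_quadratic_convex:
  fixes B :: "'a::real_inner \<Rightarrow> 'a"
  assumes "linear B" and psd: "\<And>q. 0 \<le> q \<bullet> B q"
  shows "convex_on UNIV (\<lambda>q. q \<bullet> B q)"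
proof (rule convex_onI)
  fix t :: real and a b :: 'a assume t: "0 < t" "t < 1"
  \<comment> \<open>The convexity defect of a quadratic form is exactly a multiple of the form at
    \<open>a - b\<close>.\<close>
  have "((1 - t) *\<^sub>R a + t *\<^sub>R b) \<bullet> B ((1 - t) *\<^sub>R a + t *\<^sub>R b)
      = (1 - t) * (a \<bullet> B a) + t * (b \<bullet> B b) - t * (1 - t) * ((a - b) \<bullet> B (a - b))"
    by (simp add: linear_add[OF assms(1)] linear_scale[OF assms(1)] linear_diff[OF assms(1)]
        inner_add_left inner_add_right inner_diff_left inner_diff_right algebra_simps)
  moreover have "0 \<le> t * (1 - t) * ((a - b) \<bullet> B (a - b))" using t psd by simp
  ultimately show "((1 - t) *\<^sub>R a + t *\<^sub>R b) \<bullet> B ((1 - t) *\<^sub>R a + t *\<^sub>R b)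
      \<le> (1 - t) * (a \<bullet> B a) + t * (b \<bullet> B b)" by linarith
qed simp

subsection \<open>The Laplacian map\<close>

text \<open>The Dirichlet energy of the weighted graph. Averaging the double sum with its transpose
  turns \<open>y $ i * (y $ i - y $ j)\<close> into half a square.\<close>

lemma inner_laplacian:
  fixes A :: "real^'n^'n"
  assumes sym: "\<And>i j. A $ i $ j = A $ j $ i"
  shows "y \<bullet> (laplacian A *v y) = 1 / 2 * (\<Sum>i\<in>UNIV. \<Sum>j\<in>UNIV. A $ i $ j * (y $ i - y $ j)\<^sup>2)"
proof -
  have Lv: "(laplacian A *v y) $ i = (\<Sum>j\<in>UNIV. A $ i $ j * (y $ i - y $ j))" for i
  proof -
    have "(laplacian A *v y) $ i = (\<Sum>j\<in>UNIV. (if i = j then (\<Sum>k\<in>UNIV. A $ i $ k) else 0) * y $ j - A $ i $ j * y $ j)"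
      by (simp add: laplacian_def degree_matrix_def matrix_vector_mult_def left_diff_distrib)
    also have "\<dots> = (\<Sum>j\<in>UNIV. if i = j then (\<Sum>k\<in>UNIV. A $ i $ k) * y $ j else 0) - (\<Sum>j\<in>UNIV. A $ i $ j * y $ j)"
      by (simp add: sum_subtractf if_distrib[of "\<lambda>x. x * _"] cong: if_cong)
    also have "\<dots> = (\<Sum>j\<in>UNIV. A $ i $ j * y $ i) - (\<Sum>j\<in>UNIV. A $ i $ j * y $ j)"
      by (simp add: sum_distrib_right)
    finally show ?thesis by (simp add: right_diff_distrib sum_subtractf)
  qed
  define S where "S = (\<Sum>i\<in>UNIV. \<Sum>j\<in>UNIV. A $ i $ j * (y $ i * (y $ i - y $ j)))"
  have S: "y \<bullet> (laplacian A *v y) = S"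
    by (simp add: inner_vec_def Lv sum_distrib_left S_def mult_ac)
  have "S = (\<Sum>j\<in>UNIV. \<Sum>i\<in>UNIV. A $ i $ j * (y $ i * (y $ i - y $ j)))"
    unfolding S_def by (rule sum.swap)
  also have "\<dots> = (\<Sum>i\<in>UNIV. \<Sum>j\<in>UNIV. A $ i $ j * (y $ j * (y $ j - y $ i)))"
    using sym by (intro sum.cong) auto
  finally have "S + S = (\<Sum>i\<in>UNIV. \<Sum>j\<in>UNIV. A $ i $ j * (y $ i * (y $ i - y $ j)) + A $ i $ j * (y $ j * (y $ j - y $ i)))"
    using S_def by (simp add: sum.distrib)
  also have "\<dots> = (\<Sum>i\<in>UNIV. \<Sum>j\<in>UNIV. A $ i $ j * (y $ i - y $ j)\<^sup>2)"
    by (intro sum.cong) (auto simp: power2_eq_square algebra_simps)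
  finally show ?thesis unfolding S by simp
qed

text \<open>For a fixed coordinate \<open>a\<close> the agents' values form a vector on which
  \<open>M\<close> acts alone, so the properties of the Laplacian carry over coordinate by
  coordinate.\<close>

lemma kronecker_mat_1_mult:
  fixes M :: "real^'n::finite^'n"
  shows "(kronecker M (mat 1 :: real^'d::finite^'d) *v x) $ (i, a) = (M *v (\<chi> j. x $ (j, a))) $ i"
proof -
  have "(kronecker M (mat 1 :: real^'d^'d) *v x) $ (i, a)
      = (\<Sum>q\<in>UNIV. M $ i $ fst q * (if a = snd q then 1 else 0) * x $ q)"
    by (simp add: matrix_vector_mult_def kronecker_def mat_def)
  also have "\<dots> = (\<Sum>j\<in>UNIV. \<Sum>b\<in>UNIV. M $ i $ j * (if a = b then 1 else 0) * x $ (j, b))"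
    by (simp add: UNIV_Times_UNIV[symmetric] sum.cartesian_product case_prod_unfold del: UNIV_Times_UNIV)
  also have "\<dots> = (\<Sum>j\<in>UNIV. M $ i $ j * x $ (j, a))"
  proof (rule sum.cong)
    fix j
    have "(\<Sum>b\<in>UNIV. M $ i $ j * (if a = b then 1 else 0) * x $ (j, b)) = (\<Sum>b\<in>UNIV. if a = b then M $ i $ j * x $ (j, b) else 0)"
      by (intro sum.cong) auto
    then show "(\<Sum>b\<in>UNIV. M $ i $ j * (if a = b then 1 else 0) * x $ (j, b)) = M $ i $ j * x $ (j, a)" by simp
  qed simp
  finally show ?thesis by (simp add: matrix_vector_mult_def)
qed

lemma inner_kronecker_mat_1:
  fixes M :: "real^'n::finite^'n"
  shows "y \<bullet> (kronecker M (mat 1 :: real^'d::finite^'d) *v x)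
    = (\<Sum>a\<in>UNIV. (\<chi> i. y $ (i, a)) \<bullet> (M *v (\<chi> i. x $ (i, a))))"
proof -
  have "y \<bullet> (kronecker M (mat 1 :: real^'d^'d) *v x)
      = (\<Sum>i\<in>UNIV. \<Sum>a\<in>UNIV. y $ (i, a) * (kronecker M (mat 1 :: real^'d^'d) *v x) $ (i, a))"
    by (simp add: inner_vec_def UNIV_Times_UNIV[symmetric] sum.cartesian_product case_prod_unfold del: UNIV_Times_UNIV)
  also have "\<dots> = (\<Sum>a\<in>UNIV. \<Sum>i\<in>UNIV. y $ (i, a) * (M *v (\<chi> j. x $ (j, a))) $ i)"
    unfolding kronecker_mat_1_mult by (rule sum.swap)
  finally show ?thesis by (simp add: inner_vec_def)
qed

text \<open>The components follow the primal pair \<open>(x, l)\<close>. The multiplier paired with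
  it is therefore \<open>(\<eta>, \<nu>)\<close>, in the reverse of the order in which
  \<open>Laug_tilde\<close> takes these arguments.\<close>

definition consensus_map :: "real^'n^'n \<Rightarrow> (real^('n::finite \<times> 'd::finite)) \<times> (real^'n) \<Rightarrow> (real^('n \<times> 'd)) \<times> (real^'n)" where
  "consensus_map A = (\<lambda>(x, l). (kronecker (laplacian A) (mat 1 :: real^'d^'d) *v x, laplacian A *v l))"

lemma linear_consensus_map: "linear (consensus_map A)"
  by (auto simp: linear_iff consensus_map_def matrix_vector_right_distrib matrix_vector_mult_scaleR)

lemma consensus_map_psd:
  assumes "weighted_graph E A"
  shows "0 \<le> p \<bullet> consensus_map A p"
proof -
  have "transpose A = A" using assms by (simp add: weighted_graph_def)
  then have "transpose A $ i $ j = A $ i $ j" for i j by simp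
  then have sym: "A $ i $ j = A $ j $ i" for i j by (simp add: transpose_def)
  have nn: "0 \<le> A $ i $ j" for i j
    using assms unfolding weighted_graph_def by (cases "(i, j) \<in> E") (auto intro: less_imp_le)
  have "0 \<le> y \<bullet> (laplacian A *v y)" for y
    unfolding inner_laplacian[OF sym] by (intro mult_nonneg_nonneg sum_nonneg) (auto simp: nn)
  then show ?thesis
    by (cases p) (auto simp: consensus_map_def inner_kronecker_mat_1 intro!: add_nonneg_nonneg sum_nonneg)
qed

lemma consensus_map_symmetric:
  fixes p q :: "(real^('a::finite \<times> 'b::finite)) \<times> (real^'a)"
  assumes "weighted_graph E A"
  shows "p \<bullet> consensus_map A q = consensus_map A p \<bullet> q"
proof -
  have tr: "transpose (laplacian A) = laplacian A"
    using assms by (auto simp: weighted_graph_def transpose_def laplacian_def degree_matrix_def vec_eq_iff)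
  have L: "y \<bullet> (laplacian A *v w) = (laplacian A *v y) \<bullet> w" for y w
    using dot_lmul_matrix[of y "laplacian A" w] tr
    by (metis transpose_matrix_vector)
  have K: "y \<bullet> (kronecker (laplacian A) (mat 1 :: real^'b^'b) *v w)
      = (kronecker (laplacian A) (mat 1 :: real^'b^'b) *v y) \<bullet> w" for y w :: "real^('a \<times> 'b::finite)"
    unfolding inner_kronecker_mat_1 inner_commute[of _ w] by (intro sum.cong refl) (metis L inner_commute)
  show ?thesis
    by (cases p; cases q) (simp add: consensus_map_def L K)
qed

subsection \<open>The distributionally robust problem\<close>

text \<open>The function \<Phi> of the flow: \<open>F\<close> with each maximum replaced by
  evaluation at a block of \<open>z\<close>.\<close>

definition data_term :: "(real^'d \<Rightarrow> real^'m \<Rightarrow> real) \<Rightarrow> ('N::finite \<Rightarrow> real^'m) \<Rightarrow> real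
    \<Rightarrow> ('N \<Rightarrow> 'n) \<Rightarrow> (real^('n::finite \<times> 'd::finite)) \<times> (real^'n) \<Rightarrow> real^'m^'N \<Rightarrow> real" where
  "data_term f samp \<epsilon> v = (\<lambda>(x, l) z.
     h \<epsilon> l + 1 / real CARD('N) * (\<Sum>k\<in>UNIV. g f samp k (block x (v k)) (l $ v k) (z $ k)))"

lemma Laug_tilde_eq:
  "Laug_tilde f samp \<epsilon> v A x l \<nu> \<eta> z = data_term f samp \<epsilon> v (x, l) z
     + (\<eta>, \<nu>) \<bullet> consensus_map A (x, l) + 1 / 2 * ((x, l) \<bullet> consensus_map A (x, l))"
  by (simp add: Laug_tilde_def data_term_def consensus_terms_def consensus_map_def Let_def algebra_simps)

lemma bounded_linear_block: "bounded_linear (\<lambda>x. block x i)"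
  by (auto simp: linear_conv_bounded_linear[symmetric] linear_iff block_def vec_eq_iff)

lemma block_convex_combination:
  "block ((1 - t) *\<^sub>R x + t *\<^sub>R y) i = (1 - t) *\<^sub>R block x i + t *\<^sub>R block y i"
  by (simp add: block_def vec_eq_iff)

lemma h_eq: "h \<epsilon> (l :: real^'n::finite) = \<epsilon>\<^sup>2 / real CARD('n) * (1 \<bullet> l)"
  by (simp add: h_def)

lemma data_term_differentiable:
  fixes f :: "real^'d::finite \<Rightarrow> real^'m::finite \<Rightarrow> real" and samp :: "'N::finite \<Rightarrow> real^'m"
    and v :: "'N \<Rightarrow> 'n::finite"
  assumes "continuously_differentiable (\<lambda>(y, \<zeta>). f y \<zeta>)"
  shows "(\<lambda>(p, z). data_term f samp \<epsilon> v p z) differentiable (at w)"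
proof -
  let ?x = "\<lambda>w :: ((real^('n \<times> 'd)) \<times> (real^'n)) \<times> (real^'m^'N). fst (fst w)"
  let ?l = "\<lambda>w :: ((real^('n \<times> 'd)) \<times> (real^'n)) \<times> (real^'m^'N). snd (fst w)"
  have f: "(\<lambda>(y, \<zeta>). f y \<zeta>) differentiable (at u)" for u
    using assms unfolding continuously_differentiable_def differentiable_def by blast
  have l: "bounded_linear (\<lambda>w. ?l w $ i)" for i
    by (rule bounded_linear_compose[OF bounded_linear_vec_nth])
      (rule bounded_linear_compose[OF bounded_linear_snd bounded_linear_fst])
  have z: "bounded_linear (\<lambda>w :: ((real^('n \<times> 'd)) \<times> (real^'n)) \<times> (real^'m^'N). snd w $ k)" for k
    by (rule bounded_linear_compose[OF bounded_linear_vec_nth bounded_linear_snd])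
  have h: "bounded_linear (\<lambda>w. h \<epsilon> (?l w))"
    unfolding h_eq
    by (rule bounded_linear_const_mult, rule bounded_linear_compose[OF bounded_linear_inner_right])
      (rule bounded_linear_compose[OF bounded_linear_snd bounded_linear_fst])
  have "(\<lambda>w. f (block (?x w) (v k)) (snd w $ k)) differentiable (at w)" for k
  proof -
    have "bounded_linear (\<lambda>w. block (?x w) (v k))"
      by (rule bounded_linear_compose[OF bounded_linear_block])
        (rule bounded_linear_compose[OF bounded_linear_fst bounded_linear_fst])
    then have "bounded_linear (\<lambda>w. (block (?x w) (v k), snd w $ k))"
      by (intro bounded_linear_Pair z)
    then have "(\<lambda>w. (block (?x w) (v k), snd w $ k)) differentiable (at w)"
      by (rule bounded_linear_imp_differentiable)
    from differentiable_chain_at[OF this f] show ?thesis by (simp add: o_def)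
  qed
  moreover have "(\<lambda>w. (norm (snd w $ k - samp k))\<^sup>2) differentiable (at w)" for k
  proof -
    have "((\<lambda>w. snd w $ k - samp k) has_derivative (\<lambda>w. snd w $ k)) (at w)"
      using has_derivative_diff[OF bounded_linear_imp_has_derivative[OF z] has_derivative_const] by simp
    from has_derivative_inner[OF this this] show ?thesis
      unfolding power2_norm_eq_inner differentiable_def by blast
  qed
  ultimately have "(\<lambda>w. f (block (?x w) (v k)) (snd w $ k) - ?l w $ v k * (norm (snd w $ k - samp k))\<^sup>2) differentiable (at w)" for k
    by (intro differentiable_mult differentiable_diff bounded_linear_imp_differentiable[OF l])
  then have "(\<lambda>w. h \<epsilon> (?l w) + 1 / real CARD('N) *
      (\<Sum>k\<in>UNIV. f (block (?x w) (v k)) (snd w $ k) - ?l w $ v k * (norm (snd w $ k - samp k))\<^sup>2)) differentiable (at w)"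
    by (intro differentiable_add differentiable_mult differentiable_const differentiable_sum
        bounded_linear_imp_differentiable[OF h]) auto
  then show ?thesis by (simp add: data_term_def g_def case_prod_unfold)
qed

text \<open>For fixed \<open>z\<close> the multipliers \<open>l\<close> enter linearly and
  \<open>f\<close> is convex in its first argument, so convexity holds on the whole space, negative
  \<open>l\<close> included. \<open>quad_growth\<close> depends on this.\<close>

lemma data_term_convex:
  fixes f :: "real^'d::finite \<Rightarrow> real^'m::finite \<Rightarrow> real" and samp :: "'N::finite \<Rightarrow> real^'m"
    and v :: "'N \<Rightarrow> 'n::finite"
  assumes "\<And>\<zeta>. convex_on UNIV (\<lambda>y. f y \<zeta>)"
  shows "convex_on UNIV (\<lambda>p. data_term f samp \<epsilon> v p z)"
proof (rule convex_onI)
  fix t :: real and a b :: "(real^('n \<times> 'd)) \<times> (real^'n)" assume t: "0 < t" "t < 1"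
  have "g f samp k (block ((1 - t) *\<^sub>R fst a + t *\<^sub>R fst b) (v k)) (((1 - t) *\<^sub>R snd a + t *\<^sub>R snd b) $ v k) (z $ k)
      \<le> (1 - t) * g f samp k (block (fst a) (v k)) (snd a $ v k) (z $ k)
        + t * g f samp k (block (fst b) (v k)) (snd b $ v k) (z $ k)" for k
  proof -
    have "f ((1 - t) *\<^sub>R block (fst a) (v k) + t *\<^sub>R block (fst b) (v k)) (z $ k)
        \<le> (1 - t) * f (block (fst a) (v k)) (z $ k) + t * f (block (fst b) (v k)) (z $ k)"
      using t by (intro convex_onD[OF assms]) auto
    then show ?thesis unfolding g_def block_convex_combination by (simp add: algebra_simps)
  qed
  then have "(\<Sum>k\<in>UNIV. g f samp k (block ((1 - t) *\<^sub>R fst a + t *\<^sub>R fst b) (v k)) (((1 - t) *\<^sub>R snd a + t *\<^sub>R snd b) $ v k) (z $ k))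
      \<le> (1 - t) * (\<Sum>k\<in>UNIV. g f samp k (block (fst a) (v k)) (snd a $ v k) (z $ k))
        + t * (\<Sum>k\<in>UNIV. g f samp k (block (fst b) (v k)) (snd b $ v k) (z $ k))" (is "?s \<le> (1 - t) * ?sa + t * ?sb")
    by (simp add: sum_distrib_left sum.distrib[symmetric] sum_mono)
  then have "1 / real CARD('N) * ?s \<le> 1 / real CARD('N) * ((1 - t) * ?sa + t * ?sb)"
    by (rule mult_left_mono) simp
  moreover have "h \<epsilon> ((1 - t) *\<^sub>R snd a + t *\<^sub>R snd b) = (1 - t) * h \<epsilon> (snd a) + t * h \<epsilon> (snd b)"
    by (simp add: h_def inner_add_right distrib_left add_divide_distrib mult_ac)
  moreover have "(1 - t) * (u + c * r) + t * (u' + c * r') = ((1 - t) * u + t * u') + c * ((1 - t) * r + t * r')"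
    for c u u' r r' :: real
    by (simp add: algebra_simps)
  ultimately show "data_term f samp \<epsilon> v ((1 - t) *\<^sub>R a + t *\<^sub>R b) z
      \<le> (1 - t) * data_term f samp \<epsilon> v a z + t * data_term f samp \<epsilon> v b z"
    by (simp only: data_term_def case_prod_unfold fst_add snd_add fst_scaleR snd_scaleR add_left_mono)
qed simp

lemma F_ge_data_term:
  fixes v :: "'N::finite \<Rightarrow> 'n::finite"
  shows "ereal (data_term f samp \<epsilon> v (x, l) z) \<le> F f samp \<epsilon> v x l"
proof -
  have "ereal (\<Sum>k\<in>UNIV. g f samp k (block x (v k)) (l $ v k) (z $ k))
      = (\<Sum>k\<in>UNIV. ereal (g f samp k (block x (v k)) (l $ v k) (z $ k)))" by simp
  also have "\<dots> \<le> (\<Sum>k\<in>UNIV. SUP \<xi>. ereal (g f samp k (block x (v k)) (l $ v k) \<xi>))"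
    by (intro sum_mono SUP_upper) simp
  finally have "ereal (1 / real CARD('N)) * ereal (\<Sum>k\<in>UNIV. g f samp k (block x (v k)) (l $ v k) (z $ k))
      \<le> ereal (1 / real CARD('N)) * (\<Sum>k\<in>UNIV. SUP \<xi>. ereal (g f samp k (block x (v k)) (l $ v k) \<xi>))"
    by (rule ereal_mult_left_mono) simp
  then have "ereal (h \<epsilon> l) + ereal (1 / real CARD('N)) * ereal (\<Sum>k\<in>UNIV. g f samp k (block x (v k)) (l $ v k) (z $ k))
      \<le> F f samp \<epsilon> v x l"
    unfolding F_def by (rule add_left_mono)
  then show ?thesis by (simp add: data_term_def)
qed

lemma data_term_coordinate_max:
  fixes f :: "real^'d::finite \<Rightarrow> real^'m::finite \<Rightarrow> real" and samp :: "'N::finite \<Rightarrow> real^'m"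
    and v :: "'N \<Rightarrow> 'n::finite"
  assumes "\<And>z'. data_term f samp \<epsilon> v (x, l) z' \<le> data_term f samp \<epsilon> v (x, l) z"
  shows "g f samp k (block x (v k)) (l $ v k) \<zeta> \<le> g f samp k (block x (v k)) (l $ v k) (z $ k)"
proof (rule sum_coordinate_max)
  fix z' :: "real^'m^'N"
  have "1 / real CARD('N) * (\<Sum>k\<in>UNIV. g f samp k (block x (v k)) (l $ v k) (z' $ k))
      \<le> 1 / real CARD('N) * (\<Sum>k\<in>UNIV. g f samp k (block x (v k)) (l $ v k) (z $ k))"
    using assms[of z'] by (simp add: data_term_def)
  then show "(\<Sum>k\<in>UNIV. g f samp k (block x (v k)) (l $ v k) (z' $ k))
      \<le> (\<Sum>k\<in>UNIV. g f samp k (block x (v k)) (l $ v k) (z $ k))"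
    by (rule mult_left_le_imp_le) simp
qed

text \<open>The samples decouple, so a joint maximizer attains each supremum separately and
  \<open>F\<close> is finite there. With \<open>F_ge_data_term\<close> this forms the weak duality
  argument for (D).\<close>

lemma F_eq_data_term:
  fixes f :: "real^'d::finite \<Rightarrow> real^'m::finite \<Rightarrow> real" and samp :: "'N::finite \<Rightarrow> real^'m"
    and v :: "'N \<Rightarrow> 'n::finite"
  assumes "\<And>z'. data_term f samp \<epsilon> v (x, l) z' \<le> data_term f samp \<epsilon> v (x, l) z"
  shows "F f samp \<epsilon> v x l = ereal (data_term f samp \<epsilon> v (x, l) z)"
proof -
  have "(SUP \<xi>. ereal (g f samp k (block x (v k)) (l $ v k) \<xi>)) = ereal (g f samp k (block x (v k)) (l $ v k) (z $ k))" for k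
    using data_term_coordinate_max[OF assms] by (intro antisym SUP_least SUP_upper) auto
  then show ?thesis by (simp add: F_def data_term_def)
qed

lemma data_term_quadratic_growth:
  fixes f :: "real^'d::finite \<Rightarrow> real^'m::finite \<Rightarrow> real" and samp :: "'N::finite \<Rightarrow> real^'m"
    and v :: "'N \<Rightarrow> 'n::finite"
  assumes max: "\<And>z'. data_term f samp \<epsilon> v (x, l) z' \<le> data_term f samp \<epsilon> v (x, l) z"
    and strong: "\<And>k. strongly_concave (\<lambda>\<zeta>. g f samp k (block x (v k)) (l $ v k) \<zeta>)"
  obtains c where "c > 0" "\<And>y. c * (norm (y - z))\<^sup>2
      \<le> data_term f samp \<epsilon> v (x, l) z - data_term f samp \<epsilon> v (x, l) y"
proof -
  have "\<exists>c>0. \<forall>y. c * (norm (y - z $ k))\<^sup>2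
      \<le> g f samp k (block x (v k)) (l $ v k) (z $ k) - g f samp k (block x (v k)) (l $ v k) y" for k
    by (rule strongly_concave_quadratic_growth[OF strong[of k] data_term_coordinate_max[OF max]]) blast
  then obtain c where c: "\<And>k. c k > 0" "\<And>k y. c k * (norm (y - z $ k))\<^sup>2
      \<le> g f samp k (block x (v k)) (l $ v k) (z $ k) - g f samp k (block x (v k)) (l $ v k) y"
    by metis
  \<comment> \<open>One modulus for all samples; the average over them adds the factor
    \<open>1 / real CARD('N)\<close>.\<close>
  define c0 where "c0 = Min (range c)"
  have c0: "c0 > 0" "\<And>k. c0 \<le> c k" using c(1) by (auto simp: c0_def)
  have "1 / real CARD('N) * c0 * (norm (y - z))\<^sup>2
      \<le> data_term f samp \<epsilon> v (x, l) z - data_term f samp \<epsilon> v (x, l) y" for y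
  proof -
    have "(norm (y - z))\<^sup>2 = (\<Sum>k\<in>UNIV. (norm (y $ k - z $ k))\<^sup>2)"
      by (simp add: power2_norm_eq_inner inner_vec_def)
    then have "c0 * (norm (y - z))\<^sup>2 = (\<Sum>k\<in>UNIV. c0 * (norm (y $ k - z $ k))\<^sup>2)" by (simp add: sum_distrib_left)
    also have "\<dots> \<le> (\<Sum>k\<in>UNIV. g f samp k (block x (v k)) (l $ v k) (z $ k) - g f samp k (block x (v k)) (l $ v k) (y $ k))"
    proof (rule sum_mono)
      fix k
      have "c0 * (norm (y $ k - z $ k))\<^sup>2 \<le> c k * (norm (y $ k - z $ k))\<^sup>2"
        using c0(2) by (rule mult_right_mono) simp
      also note c(2)
      finally show "c0 * (norm (y $ k - z $ k))\<^sup>2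
        \<le> g f samp k (block x (v k)) (l $ v k) (z $ k) - g f samp k (block x (v k)) (l $ v k) (y $ k)" .
    qed
    finally have "1 / real CARD('N) * (c0 * (norm (y - z))\<^sup>2) \<le> 1 / real CARD('N) *
        (\<Sum>k\<in>UNIV. g f samp k (block x (v k)) (l $ v k) (z $ k) - g f samp k (block x (v k)) (l $ v k) (y $ k))"
      by (rule mult_left_mono) simp
    then show ?thesis by (simp add: data_term_def sum_subtractf diff_divide_distrib mult.assoc)
  qed
  then show thesis using that[of "1 / real CARD('N) * c0"] c0(1) by simp
qed

text \<open>Passing from the order \<open>(x, l, \<nu>, \<eta>, \<xi>)\<close> to
  \<open>((x, l), (\<eta>, \<nu>), \<xi>)\<close> is an isometry, hence keeps absolute
  continuity.\<close>

lemma dist_Pair_rearrange: "dist ((a, b), (d, c), e) ((a', b'), (d', c'), e') = dist (a, b, c, d, e) (a', b', c', d', e')"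
  by (simp add: dist_Pair_Pair algebra_simps)

theorem mainTheorem5:
  fixes \<epsilon> :: real
    and E :: "('n::finite \<times> 'n) set"
    and A :: "real^'n^'n"
    and samp :: "'N::finite \<Rightarrow> real^'m::finite"
    and v :: "'N \<Rightarrow> 'n"
    and f :: "real^'d::finite \<Rightarrow> real^'m \<Rightarrow> real"
    and C :: "((real^('n \<times> 'd)) \<times> (real^'n)) set"
    and x :: "real \<Rightarrow> real^('n \<times> 'd)" and l :: "real \<Rightarrow> real^'n"
    and \<nu> :: "real \<Rightarrow> real^'n" and \<eta> :: "real \<Rightarrow> real^('n \<times> 'd)"
    and \<xi> :: "real \<Rightarrow> real^'m^'N"
  assumes "0 \<le> \<epsilon>"
    and "weighted_graph E A" and "connected_graph E"
    and "surj v"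
    and "continuously_differentiable (\<lambda>(y, \<zeta>). f y \<zeta>)"
    and "\<And>\<zeta>. convex_on UNIV (\<lambda>y. f y \<zeta>)"
    and "\<And>y. convex_on UNIV (f y) \<or> concave_on UNIV (f y)"
    and "closure {\<zeta>. \<not> recession_direction (\<lambda>y. f y \<zeta>) 1 \<and>
           \<not> recession_direction (\<lambda>y. f y \<zeta>) (- 1)} = UNIV"
    and "interior (finite_set_P f samp \<epsilon>) \<noteq> {}"
    and "\<exists>y \<mu>. optimizer_P f samp \<epsilon> y \<mu>"
    and "C \<subseteq> UNIV \<times> {\<mu>. 0 \<le> \<mu>}" and "closed C" and "convex C" and "interior C \<noteq> {}"
    and saddle_points_in_C:
      "\<And>p q. saddle_point (UNIV \<times> {\<mu>. 0 \<le> \<mu>}) UNIV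
           (\<lambda>(y, \<mu>) (n, e). Laug f samp \<epsilon> v A y \<mu> n e) p q \<Longrightarrow> p \<in> C"
    and convex_in_primal:
      "\<And>n e z. convex_on C (\<lambda>(y, \<mu>). Laug_tilde f samp \<epsilon> v A y \<mu> n e z)"
    and concave_in_dual:
      "\<And>y \<mu>. (y, \<mu>) \<in> C \<Longrightarrow> concave_on UNIV (\<lambda>(n, e, z). Laug_tilde f samp \<epsilon> v A y \<mu> n e z)"
    and minmax:
      "\<And>n e. (INF (y, \<mu>)\<in>C. SUP z. ereal (Laug_tilde f samp \<epsilon> v A y \<mu> n e z)) =
             (SUP z. INF (y, \<mu>)\<in>C. ereal (Laug_tilde f samp \<epsilon> v A y \<mu> n e z))"
    and strong_saddle_point:
      "\<exists>y \<mu> n e z.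
         saddle_point C UNIV
           (\<lambda>(y, \<mu>) (n, e, z). Laug_tilde f samp \<epsilon> v A y \<mu> n e z) (y, \<mu>) (n, e, z) \<and>
         (y, \<mu>) \<in> interior C \<and>
         (\<forall>k. strongly_concave (\<lambda>\<zeta>. g f samp k (block y (v k)) (\<mu> $ v k) \<zeta>))"
    and trajectory: "SP_trajectory f samp \<epsilon> v A C x l \<nu> \<eta> \<xi>"
    and start: "((x 0, l 0), \<nu> 0, \<eta> 0, \<xi> 0) \<in> C \<times> UNIV"
  shows "(\<forall>t\<ge>0. ((x t, l t), \<nu> t, \<eta> t, \<xi> t) \<in> C \<times> UNIV) \<and>
    (\<exists>y \<mu> n e z.
       saddle_point C UNIV
         (\<lambda>(y, \<mu>) (n, e, z). Laug_tilde f samp \<epsilon> v A y \<mu> n e z) (y, \<mu>) (n, e, z) \<and>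
       (x \<longlongrightarrow> y) at_top \<and> (l \<longlongrightarrow> \<mu>) at_top \<and> (\<nu> \<longlongrightarrow> n) at_top \<and>
       (\<eta> \<longlongrightarrow> e) at_top \<and> (\<xi> \<longlongrightarrow> z) at_top \<and>
       optimizer_D f samp \<epsilon> v A y \<mu>)"
proof -
  let ?\<Phi> = "data_term f samp \<epsilon> v"
  let ?B = "consensus_map A :: (real^('n \<times> 'd)) \<times> (real^'n) \<Rightarrow> _"
  let ?Lt = "Laug_tilde f samp \<epsilon> v A"
  define L where "L p m z = ?\<Phi> p z + m \<bullet> ?B p + 1 / 2 * (p \<bullet> ?B p)" for p m z
  define GP where "GP p m z = (gradient (\<lambda>y. L (y, snd p) m z) (fst p), gradient (\<lambda>y. L (fst p, y) m z) (snd p))" for p m z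
  define GZ where "GZ p z = (\<chi> k. gradient (\<lambda>y. ?\<Phi> p (\<chi> j. if j = k then y else z $ j)) (z $ k))" for p z
  have Lt: "?Lt y \<mu> n e z = L (y, \<mu>) (e, n) z" for y \<mu> n e z
    by (simp add: L_def Laug_tilde_eq)
  have diff: "(\<lambda>(p, z). ?\<Phi> p z) differentiable (at w)" for w
    by (rule data_term_differentiable) fact
  have diff_p: "(\<lambda>p. ?\<Phi> p z) differentiable (at p)" for p z
  proof -
    have "(\<lambda>p. (p, z)) differentiable (at p)"
      by (auto simp: differentiable_def intro!: derivative_eq_intros exI)
    from differentiable_chain_at[OF this diff] show ?thesis by (simp add: o_def)
  qed
  have diff_z: "(\<lambda>z. ?\<Phi> p z) differentiable (at z)" for p z
  proof -
    have "(\<lambda>z. (p, z)) differentiable (at z)"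
      by (auto simp: differentiable_def intro!: derivative_eq_intros exI)
    from differentiable_chain_at[OF this diff] show ?thesis by (simp add: o_def)
  qed
  have lin: "linear ?B" by (rule linear_consensus_map)
  then have blin: "bounded_linear ?B" by (simp add: linear_conv_bounded_linear)
  have psd: "0 \<le> p \<bullet> ?B p" for p by (rule consensus_map_psd) fact
  have \<Phi>_convex: "convex_on UNIV (\<lambda>p. ?\<Phi> p z)" for z by (rule data_term_convex) fact
  have L_convex: "convex_on UNIV (\<lambda>p. L p m z)" for m z
  proof -
    have "convex_on UNIV (\<lambda>p. m \<bullet> ?B p)"
      by (rule convex_onI) (simp_all add: linear_add[OF lin] linear_scale[OF lin] inner_add_right)
    then show ?thesis
      unfolding L_def by (intro convex_on_add convex_on_cmul \<Phi>_convex psd_quadratic_convex[OF lin psd]) auto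
  qed
  have L_diff: "(\<lambda>p. L p m z) differentiable (at p)" for p m z
  proof -
    have B: "(?B has_derivative ?B) (at p)" by (rule bounded_linear_imp_has_derivative[OF blin])
    have "(\<lambda>p. m \<bullet> ?B p) differentiable (at p)"
      unfolding differentiable_def using has_derivative_inner[OF has_derivative_const B] by blast
    moreover have "(\<lambda>p. p \<bullet> ?B p) differentiable (at p)"
      unfolding differentiable_def using has_derivative_inner[OF has_derivative_ident B] by blast
    ultimately show ?thesis unfolding L_def by (intro differentiable_add differentiable_mult differentiable_const diff_p)
  qed
  have grad_p: "GP p m z \<bullet> (p' - p) \<le> L p' m z - L p m z" for p p' m z
    using GDERIV_Pair[of "\<lambda>p. L p m z" "fst p" "snd p"] L_diff
    by (intro convex_on_gradient_inequality[OF L_convex]) (auto simp: GP_def)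
  have grad_z: "?\<Phi> p z' - ?\<Phi> p z \<le> GZ p z \<bullet> (z' - z)" if "p \<in> C" for p z z'
  proof -
    have "concave_on UNIV (\<lambda>(n, e, z). ?Lt (fst p) (snd p) n e z)" using that by (intro concave_in_dual) simp
    then have conc: "convex_on UNIV (\<lambda>(n, e, z). - L p (e, n) z)"
      by (simp add: concave_on_def Lt case_prod_unfold)
    define r where "r = 1 / 2 * (p \<bullet> ?B p)"
    \<comment> \<open>Concavity is given jointly in the multipliers and \<open>z\<close>; at zero
      multipliers, \<open>L\<close> differs from \<Phi> by the constant \<open>r\<close>, so it
      restricts to concavity in \<open>z\<close>.\<close>
    have L0: "L p (0, 0) z = ?\<Phi> p z + r" for z by (simp add: L_def r_def zero_prod_def[symmetric])
    have "convex_on UNIV (\<lambda>z. - ?\<Phi> p z)"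
    proof (rule convex_onI)
      fix t :: real and a b :: "real^'m^'N" assume "0 < t" "t < 1"
      then show "- ?\<Phi> p ((1 - t) *\<^sub>R a + t *\<^sub>R b) \<le> (1 - t) * - ?\<Phi> p a + t * - ?\<Phi> p b"
        using convex_onD[OF conc, of t "(0, 0, a)" "(0, 0, b)"]
        by (simp add: L0 algebra_simps)
    qed simp
    moreover have "GDERIV (\<lambda>z. - ?\<Phi> p z) z :> - GZ p z"
      using GDERIV_vec[OF diff_z, of p z] unfolding GZ_def by (rule GDERIV_minus)
    ultimately have "- GZ p z \<bullet> (z' - z) \<le> - ?\<Phi> p z' - - ?\<Phi> p z"
      by (intro convex_on_gradient_inequality) auto
    then show ?thesis by simp
  qed
  obtain ys \<mu>s ns es zs where
    saddle: "saddle_point C UNIV (\<lambda>(y, \<mu>) (n, e, z). ?Lt y \<mu> n e z) (ys, \<mu>s) (ns, es, zs)"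
    and int: "(ys, \<mu>s) \<in> interior C"
    and strong: "\<And>k. strongly_concave (\<lambda>\<zeta>. g f samp k (block ys (v k)) (\<mu>s $ v k) \<zeta>)"
    using strong_saddle_point by blast
  have saddle_max: "L (ys, \<mu>s) m z \<le> L (ys, \<mu>s) (es, ns) zs" for m z
    using saddle unfolding saddle_point_def Lt by (cases m) auto
  have saddle_min: "L (ys, \<mu>s) (es, ns) zs \<le> L p (es, ns) zs" if "p \<in> C" for p
    using saddle that unfolding saddle_point_def Lt by auto
  have \<Phi>_max: "?\<Phi> (ys, \<mu>s) z \<le> ?\<Phi> (ys, \<mu>s) zs" for z
    using saddle_max[of "(es, ns)" z] by (simp add: L_def)
  obtain \<kappa> where \<kappa>: "\<kappa> > 0" "\<And>y. \<kappa> * (norm (y - zs))\<^sup>2 \<le> ?\<Phi> (ys, \<mu>s) zs - ?\<Phi> (ys, \<mu>s) y"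
    using data_term_quadratic_growth[OF \<Phi>_max strong] by blast
  interpret projected_saddle_flow C ?B ?\<Phi> GP GZ L "(ys, \<mu>s)" "(es, ns)" zs \<kappa>
    "\<lambda>t. (x t, l t)" "\<lambda>t. (\<eta> t, \<nu> t)" \<xi>
  proof (rule projected_saddle_flow.intro)
    show "continuous_on UNIV (\<lambda>(p, z). ?\<Phi> p z)"
      by (intro differentiable_imp_continuous_on differentiable_at_imp_differentiable_on diff)
    show "p \<bullet> ?B q = ?B p \<bullet> q" for p q by (rule consensus_map_symmetric) fact
    show "abs_continuous_on_interval 0 T (\<lambda>t. ((x t, l t), (\<eta> t, \<nu> t), \<xi> t))" if "0 \<le> T" for T
    proof (rule abs_continuous_on_interval_lipschitz_compose[where K = 1])
      show "abs_continuous_on_interval 0 T (\<lambda>t. (x t, l t, \<nu> t, \<eta> t, \<xi> t))"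
        using trajectory that unfolding SP_trajectory_def Let_def by blast
    qed (simp only: dist_Pair_rearrange mult_1 order_refl)
    have gm: "gradient (\<lambda>y. ?Lt (x t) (l t) y (\<eta> t) (\<xi> t)) (\<nu> t) = snd (?B (x t, l t))"
      "gradient (\<lambda>y. ?Lt (x t) (l t) (\<nu> t) y (\<xi> t)) (\<eta> t) = fst (?B (x t, l t))" for t
    proof -
      let ?b = "?B (x t, l t)" and ?r = "?\<Phi> (x t, l t) (\<xi> t) + 1 / 2 * ((x t, l t) \<bullet> ?B (x t, l t))"
      have "(\<lambda>y. ?Lt (x t) (l t) y (\<eta> t) (\<xi> t)) = (\<lambda>y. y \<bullet> snd ?b + (?r + \<eta> t \<bullet> fst ?b))"
        "(\<lambda>y. ?Lt (x t) (l t) (\<nu> t) y (\<xi> t)) = (\<lambda>y. y \<bullet> fst ?b + (?r + \<nu> t \<bullet> snd ?b))"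
        by (simp_all add: Lt L_def fun_eq_iff inner_prod_def)
      then show "gradient (\<lambda>y. ?Lt (x t) (l t) y (\<eta> t) (\<xi> t)) (\<nu> t) = snd ?b"
        "gradient (\<lambda>y. ?Lt (x t) (l t) (\<nu> t) y (\<xi> t)) (\<eta> t) = fst ?b"
        by (simp_all only: gradient_add_const gradient_inner_left)
    qed
    have gz: "gradient (\<lambda>y. ?Lt (x t) (l t) (\<nu> t) (\<eta> t) (\<chi> j. if j = k then y else \<xi> t $ j)) (\<xi> t $ k)
        = GZ (x t, l t) (\<xi> t) $ k" for t k
      \<comment> \<open>Reassociation collects all terms free of \<xi> into one constant, which the
        gradient ignores.\<close>
      unfolding Lt L_def add.assoc gradient_add_const by (simp add: GZ_def)
    have gp: "- GP (x t, l t) (\<eta> t, \<nu> t) (\<xi> t) =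
        (- gradient (\<lambda>y. ?Lt y (l t) (\<nu> t) (\<eta> t) (\<xi> t)) (x t),
         - gradient (\<lambda>y. ?Lt (x t) y (\<nu> t) (\<eta> t) (\<xi> t)) (l t))" for t
      by (simp add: GP_def Lt)
    have "AE t in lborel. 0 \<le> t \<longrightarrow>
        (\<exists>u. has_projected_vector C (x t, l t) (- GP (x t, l t) (\<eta> t, \<nu> t) (\<xi> t)) u \<and>
             ((\<lambda>s. (x s, l s)) has_vector_derivative u) (at t within {0..})) \<and>
        (\<nu> has_vector_derivative snd (?B (x t, l t))) (at t within {0..}) \<and>
        (\<eta> has_vector_derivative fst (?B (x t, l t))) (at t within {0..}) \<and>
        (\<forall>k. ((\<lambda>s. \<xi> s $ k) has_vector_derivative GZ (x t, l t) (\<xi> t) $ k) (at t within {0..}))"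
      using trajectory unfolding SP_trajectory_def Let_def gm gz gp by blast
    then show "AE t in lborel. 0 \<le> t \<longrightarrow>
        (\<exists>u. has_projected_vector C (x t, l t) (- GP (x t, l t) (\<eta> t, \<nu> t) (\<xi> t)) u \<and>
             ((\<lambda>s. (x s, l s)) has_vector_derivative u) (at t within {0..})) \<and>
        ((\<lambda>t. (\<eta> t, \<nu> t)) has_vector_derivative ?B (x t, l t)) (at t within {0..}) \<and>
        (\<xi> has_vector_derivative GZ (x t, l t) (\<xi> t)) (at t within {0..})"
    proof eventually_elim
      case (elim t)
      then show ?case
        using has_vector_derivative_Pair[of \<eta> "fst (?B (x t, l t))" t "{0..}" \<nu> "snd (?B (x t, l t))"]
          has_vector_derivative_vec_nth[of \<xi> "GZ (x t, l t) (\<xi> t)" t "{0..}"]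
        by auto
    qed
  qed (fact | rule L_def grad_z saddle_min | assumption)+
  obtain pb mb where conv: "pb \<in> C" "((\<lambda>t. (x t, l t)) \<longlongrightarrow> pb) at_top" "((\<lambda>t. (\<eta> t, \<nu> t)) \<longlongrightarrow> mb) at_top"
    and B0: "?B pb = 0" and max: "\<And>n y. L pb n y \<le> L pb mb zs" and min: "\<And>q. q \<in> C \<Longrightarrow> L pb mb zs \<le> L q mb zs"
    and val: "L pb mb zs = L (ys, \<mu>s) (es, ns) zs"
    using that by (rule convergence)
  obtain yb \<mu>b eb nb where pb: "pb = (yb, \<mu>b)" and mb: "mb = (eb, nb)" by fastforce
  have \<Phi>b_max: "?\<Phi> (yb, \<mu>b) z \<le> ?\<Phi> (yb, \<mu>b) zs" for z
    using max[of mb z] by (simp add: L_def pb)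
  have "optimizer_D f samp \<epsilon> v A yb \<mu>b"
    unfolding optimizer_D_def
  proof (intro conjI ballI, safe)
    show "(yb, \<mu>b) \<in> feasible_D A"
      using B0 conv(1) \<open>C \<subseteq> _\<close> by (auto simp: feasible_D_def consensus_map_def pb zero_prod_def)
    fix y' :: "real^('n \<times> 'd)" and \<mu>' assume "(y', \<mu>') \<in> feasible_D A"
    then have B': "?B (y', \<mu>') = 0" by (simp add: feasible_D_def consensus_map_def zero_prod_def)
    \<comment> \<open>Global minimality of the given saddle point: the competitor
      \<open>(y', \<mu>')\<close> is feasible but may lie outside \<open>C\<close>.\<close>
    have "L (ys, \<mu>s) (es, ns) zs \<le> L (y', \<mu>') (es, ns) zs"
      using quad_growth[of "(y', \<mu>')"] psd[of "(y', \<mu>')"] by simp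
    \<comment> \<open>All consensus terms vanish at both feasible points, whatever the multipliers,
      and the equality of saddle values links the limit to the given saddle point.\<close>
    then have "?\<Phi> (yb, \<mu>b) zs \<le> ?\<Phi> (y', \<mu>') zs"
      using val B0 B' by (simp add: L_def pb)
    then have "F f samp \<epsilon> v yb \<mu>b \<le> ereal (?\<Phi> (y', \<mu>') zs)"
      by (simp add: F_eq_data_term[OF \<Phi>b_max])
    also have "\<dots> \<le> F f samp \<epsilon> v y' \<mu>'" by (rule F_ge_data_term)
    finally show "F f samp \<epsilon> v yb \<mu>b \<le> F f samp \<epsilon> v y' \<mu>'" .
  qed
  moreover have "saddle_point C UNIV (\<lambda>(y, \<mu>) (n, e, z). ?Lt y \<mu> n e z) (yb, \<mu>b) (nb, eb, zs)"
    using conv(1) max min by (auto simp: saddle_point_def Lt pb mb)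
  moreover have "(x \<longlongrightarrow> yb) at_top" "(l \<longlongrightarrow> \<mu>b) at_top" "(\<nu> \<longlongrightarrow> nb) at_top" "(\<eta> \<longlongrightarrow> eb) at_top"
    using tendsto_fst[OF conv(2)] tendsto_snd[OF conv(2)] tendsto_fst[OF conv(3)] tendsto_snd[OF conv(3)]
    by (simp_all add: pb mb)
  moreover have "\<forall>t\<ge>0. ((x t, l t), \<nu> t, \<eta> t, \<xi> t) \<in> C \<times> UNIV" using p_in_C by simp
  ultimately show ?thesis using z_tendsto by blast
qed

end
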